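(* For each signed graph $\Sigma=(V,E,\sigma)$ with at least one edge, there exists a unique bivariate polynomial $\varphi(\Sigma;t,x)$, called the flow polynomial of $\Sigma$, such that for every finite abelian group $\mathbb A$, $$|{\rm F}_{\rm nz}(\Sigma,\mathbb A)|=\varphi\big(\Sigma;|{\rm Tor}_2\mathbb A|,|\mathbb A|\big).$$ Moreover, $\varphi(\Sigma;t,x)$ admits the expansion $$\varphi(\Sigma;t,x)=\sum_{S\subseteq E}(-1)^{|E\setminus S|}\,t^{u_c(S)}x^{{\rm cr}(S)},$$ and $\varphi(\Sigma;t,x)=0$ if and only if $\Sigma$ contains a co-loop, that is, an edge whose removal increases the number of balanced components by exactly one.
   Context: A graph $(V,E)$ has finite vertex set $V$ and finite edge set $E$ (multiple edges allowed); each edge has two ends, each end is attached to one vertex or to none, and at least one end is attached to a vertex. A loop has both ends at the same vertex, a link has its ends at two distinct vertices, an outer-edge has exactly one end attached to a vertex. A signed graph $\Sigma=(V,E,\sigma)$ is a graph with a sign function $\sigma:E\to\{1,-1\}$. A circle is a connected 2-regular signed (sub)graph without outer-edges (a loop with its vertex is a circle); its sign is the product of its edge signs. A signed graph is balanced if it has no outer-edges and all its circles are positive; otherwise it is unbalanced. For $S\subseteq E$, let $b(S)$ and $u_c(S)$ be the number of balanced components, resp. of unbalanced components without outer-edges, of the spanning signed subgraph $(V,S,\sigma|_S)$, and let ${\rm cr}(S)=|S|-|V|+b(S)$. ${\rm Tor}_2(\mathbb A)=\{a\in\mathbb A:2a=0\}$. Each edge $e$ has exactly two orientations (arcs) $\vec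 e$ and $\vec e^{\,-1}$: an orientation puts an arrow on each of the two ends of $e$, with the same direction along $e$ if $e$ is positive and opposite directions if $e$ is negative; $\vec e^{\,-1}$ reverses both arrows. $[v,\vec e\,]$ is $1$ (resp. $-1$) if $\vec e$ is a non-loop arc at $v$ whose arrow at $v$ points to (resp. away from) $v$; $2$ (resp. $-2$) if $\vec e$ is a negative loop at $v$ pointing to (resp. away from) $v$; $0$ otherwise. A flow over $\mathbb A$ is a function ${\bf f}$ from arcs to $\mathbb A$ with ${\bf f}(\vec e^{\,-1})=-{\bf f}(\vec e\,)$ for every edge $e$ and $\sum_{e\in E}[v,\vec e\,]{\bf f}(\vec e\,)=0$ for all $v\in V$ (one arc $\vec e$ chosen for each edge $e$; the sum does not depend on the choice). ${\rm F}_{\rm nz}(\Sigma,\mathbb A)$ is the set of flows over $\mathbb A$ with ${\bf f}(\vec e\,)\neq0$ for all $e\in E$ (nowhere-zero flows).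
   Formalization: The last clause fails as stated (a single negative loop is a co-loop, but φ = t − 1); it is proved instead that φ = 0 iff there is a co-loop whose removal also leaves the number u_c of unbalanced components without outer-edges unchanged. *)

theory Defs
  imports
    "HOL-Algebra.FiniteProduct"
    "HOL-Computational_Algebra.Polynomial"
begin

section \<open>Signed graphs\<close>

text \<open>
  The two ends of an edge \<open>e\<close> are \<open>(e, True)\<close> and \<open>(e, False)\<close>. \<open>att G e i\<close> is the vertex to
  which the end \<open>(e, i)\<close> is attached, or \<open>None\<close> if it is attached to no vertex.
\<close>

record ('v, 'e) sgraph =
  verts :: "'v set"
  edges :: "'e set"
  att :: "'e \<Rightarrow> bool \<Rightarrow> 'v option"
  esign :: "'e \<Rightarrow> int"

definition signed_graph :: "('v, 'e) sgraph \<Rightarrow> bool" where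
  "signed_graph G \<longleftrightarrow>
     finite (verts G) \<and> finite (edges G) \<and>
     (\<forall>e\<in>edges G. \<forall>i v. att G e i = Some v \<longrightarrow> v \<in> verts G) \<and>
     (\<forall>e\<in>edges G. \<exists>i. att G e i \<noteq> None) \<and>
     (\<forall>e\<in>edges G. esign G e \<in> {1, -1})"

definition is_loop :: "('v, 'e) sgraph \<Rightarrow> 'e \<Rightarrow> bool" where
  "is_loop G e \<longleftrightarrow> att G e True \<noteq> None \<and> att G e True = att G e False"

definition is_outer_edge :: "('v, 'e) sgraph \<Rightarrow> 'e \<Rightarrow> bool" where
  "is_outer_edge G e \<longleftrightarrow> (\<exists>!i. att G e i \<noteq> None)"

definition has_outer_edge :: "('v, 'e) sgraph \<Rightarrow> bool" where
  "has_outer_edge G \<longleftrightarrow> (\<exists>e\<in>edges G. is_outer_edge G e)"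


subsection \<open>Connectedness and components\<close>

definition adjacency :: "('v, 'e) sgraph \<Rightarrow> ('v \<times> 'v) set" where
  "adjacency G = {(u, v). \<exists>e\<in>edges G. \<exists>i. att G e i = Some u \<and> att G e (\<not> i) = Some v}"

definition connected_graph :: "('v, 'e) sgraph \<Rightarrow> bool" where
  "connected_graph G \<longleftrightarrow>
     verts G \<noteq> {} \<and> (\<forall>u\<in>verts G. \<forall>v\<in>verts G. (u, v) \<in> (adjacency G)\<^sup>*)"

definition component_of :: "('v, 'e) sgraph \<Rightarrow> 'v \<Rightarrow> ('v, 'e) sgraph" where
  "component_of G v =
     (let C = {w \<in> verts G. (v, w) \<in> (adjacency G)\<^sup>*}
      in G\<lparr>verts := C, edges := {e \<in> edges G. \<exists>i. \<exists>w\<in>C. att G e i = Some w}\<rparr>)"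

definition components :: "('v, 'e) sgraph \<Rightarrow> ('v, 'e) sgraph set" where
  "components G = component_of G ` verts G"


subsection \<open>Circles and balance\<close>

text \<open>A loop contributes two ends, hence \<open>2\<close> to the degree of its vertex.\<close>

definition degree_at :: "('v, 'e) sgraph \<Rightarrow> 'v \<Rightarrow> nat" where
  "degree_at G v = card {(e, i). e \<in> edges G \<and> att G e i = Some v}"

definition is_circle :: "('v, 'e) sgraph \<Rightarrow> bool" where
  "is_circle G \<longleftrightarrow>
     signed_graph G \<and> connected_graph G \<and>
     (\<forall>v\<in>verts G. degree_at G v = 2) \<and> \<not> has_outer_edge G"

definition balanced :: "('v, 'e) sgraph \<Rightarrow> bool" where
  "balanced G \<longleftrightarrow>
     \<not> has_outer_edge G \<and>
     (\<forall>W F. W \<subseteq> verts G \<longrightarrow> F \<subseteq> edges G \<longrightarrow> is_circle (G\<lparr>verts := W, edges := F\<rparr>)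
            \<longrightarrow> (\<Prod>e\<in>F. esign G e) = 1)"


subsection \<open>Spanning subgraphs and their numerical invariants\<close>

definition spanning :: "('v, 'e) sgraph \<Rightarrow> 'e set \<Rightarrow> ('v, 'e) sgraph" where
  "spanning G S = G\<lparr>edges := S\<rparr>"

definition bal :: "('v, 'e) sgraph \<Rightarrow> 'e set \<Rightarrow> nat" where
  "bal G S = card {H \<in> components (spanning G S). balanced H}"

definition unbal_closed :: "('v, 'e) sgraph \<Rightarrow> 'e set \<Rightarrow> nat" where
  "unbal_closed G S =
     card {H \<in> components (spanning G S). \<not> balanced H \<and> \<not> has_outer_edge H}"

text \<open>
  \<open>corank G S\<close> is nonnegative for \<open>S \<subseteq> edges G\<close>, because an unbalanced component has at least as
  many edges as vertices; using \<open>nat (corank G S)\<close> as an exponent therefore loses nothing.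
\<close>

definition corank :: "('v, 'e) sgraph \<Rightarrow> 'e set \<Rightarrow> int" where
  "corank G S = int (card S) - int (card (verts G)) + int (bal G S)"

text \<open>
  Pitfall: deleting a co-loop may also turn an unbalanced component without outer-edges into a
  balanced one (e.g. if the co-loop is a negative loop and the only edge). Such a co-loop \<open>e\<close>
  only forces \<open>2 f(e) = 0\<close>, and does not by itself make the flow polynomial vanish. A co-loop
  forces \<open>f(e) = 0\<close> iff its removal leaves \<open>unbal_closed\<close> unchanged.
\<close>

definition coloop :: "('v, 'e) sgraph \<Rightarrow> 'e \<Rightarrow> bool" where
  "coloop G e \<longleftrightarrow> e \<in> edges G \<and> bal G (edges G - {e}) = bal G (edges G) + 1"


section \<open>Arcs and flows\<close>

text \<open>
  An arc is a pair \<open>(e, d)\<close>, where \<open>d i\<close> is \<open>1\<close> if the arrow on the end \<open>(e, i)\<close> points outwards,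
  i.e. towards the vertex at that end, and \<open>-1\<close> if it points away from it. The two arrows have
  the same direction along \<open>e\<close> iff one of them points outwards and the other inwards.
\<close>

type_synonym 'e arc = "'e \<times> (bool \<Rightarrow> int)"

definition orientations :: "('v, 'e) sgraph \<Rightarrow> 'e \<Rightarrow> (bool \<Rightarrow> int) set" where
  "orientations G e =
     {d. (\<forall>i. d i \<in> {1, -1}) \<and>
         (if esign G e = 1 then d True \<noteq> d False else d True = d False)}"

definition arcs :: "('v, 'e) sgraph \<Rightarrow> 'e arc set" where
  "arcs G = Sigma (edges G) (orientations G)"

definition arc_inv :: "'e arc \<Rightarrow> 'e arc" where
  "arc_inv a = (fst a, \<lambda>i. - snd a i)"

definition incidence :: "('v, 'e) sgraph \<Rightarrow> 'v \<Rightarrow> 'e arc \<Rightarrow> int" where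
  "incidence G v = (\<lambda>(e, d).
     if is_loop G e then
       (if att G e True = Some v \<and> esign G e = -1 then 2 * d True else 0)
     else if att G e True = Some v then d True
     else if att G e False = Some v then d False
     else 0)"

text \<open>
  The coefficient group is written multiplicatively, as usual in \<open>HOL-Algebra\<close>: its neutral
  element \<open>\<one>\<close> plays the role of \<open>0\<close>, and \<open>[^]\<close> with an integer exponent that of an integer
  multiple. The conservation law is required for every choice \<open>w\<close> of one arc for each edge.
  Flows are extensional on \<open>arcs G\<close>, so that they can be counted.
\<close>

definition flows :: "('v, 'e) sgraph \<Rightarrow> ('g, 'm) monoid_scheme \<Rightarrow> ('e arc \<Rightarrow> 'g) set" where
  "flows G A =
     {f \<in> arcs G \<rightarrow>\<^sub>E carrier A.
        (\<forall>a\<in>arcs G. f (arc_inv a) = inv\<^bsub>A\<^esub> (f a)) \<and>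
        (\<forall>w \<in> Pi (edges G) (orientations G). \<forall>v\<in>verts G.
           (\<Otimes>\<^bsub>A\<^esub>e\<in>edges G. f (e, w e) [^]\<^bsub>A\<^esub> incidence G v (e, w e)) = \<one>\<^bsub>A\<^esub>)}"

definition nz_flows :: "('v, 'e) sgraph \<Rightarrow> ('g, 'm) monoid_scheme \<Rightarrow> ('e arc \<Rightarrow> 'g) set" where
  "nz_flows G A = {f \<in> flows G A. \<forall>a\<in>arcs G. f a \<noteq> \<one>\<^bsub>A\<^esub>}"

definition Tor2 :: "('g, 'm) monoid_scheme \<Rightarrow> 'g set" where
  "Tor2 A = {a \<in> carrier A. a [^]\<^bsub>A\<^esub> (2::nat) = \<one>\<^bsub>A\<^esub>}"


section \<open>The flow polynomial\<close>

text \<open>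
  Bivariate polynomials in \<open>t\<close> and \<open>x\<close> are represented as polynomials in \<open>t\<close> whose coefficients
  are polynomials in \<open>x\<close>.
\<close>

definition var_t :: "'c::comm_ring_1 poly poly" where
  "var_t = [:0, 1:]"

definition var_x :: "'c::comm_ring_1 poly poly" where
  "var_x = [:[:0, 1:]:]"

definition eval2 :: "'c::comm_ring_1 poly poly \<Rightarrow> 'c \<Rightarrow> 'c \<Rightarrow> 'c" where
  "eval2 p t x = poly (poly p [:t:]) x"

definition counts_flows_over ::
  "('v, 'e) sgraph \<Rightarrow> 'c::comm_ring_1 poly poly \<Rightarrow> ('g, 'm) monoid_scheme \<Rightarrow> bool" where
  "counts_flows_over G p A \<longleftrightarrow>
     of_nat (card (nz_flows G A)) = eval2 p (of_nat (card (Tor2 A))) (of_nat (card (carrier A)))"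

text \<open>
  A definition cannot quantify over the type of the group elements. The type \<open>nat\<close> is chosen
  here, since every finite group has an isomorphic copy with carrier in \<open>nat\<close>.
\<close>

definition is_flow_polynomial :: "('v, 'e) sgraph \<Rightarrow> 'c::comm_ring_1 poly poly \<Rightarrow> bool" where
  "is_flow_polynomial G p \<longleftrightarrow>
     (\<forall>A :: nat monoid. comm_group A \<longrightarrow> finite (carrier A) \<longrightarrow> counts_flows_over G p A)"

definition flow_polynomial :: "('v, 'e) sgraph \<Rightarrow> 'c::comm_ring_1 poly poly" where
  "flow_polynomial G = (THE p. is_flow_polynomial G p)"

end

theory Submission
  imports Defs
begin

text \<open>
  With one arc fixed for each edge, a flow is a function \<open>f\<close> on edges that the integer incidence
  matrix of \<open>G\<close> sends to zero, and the coefficient group only enters through this matrix. The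
  flows of \<open>G\<close> that vanish off \<open>S\<close> are the flows of the spanning subgraph \<open>(V, S)\<close>, so
  inclusion-exclusion over the zero set of a flow reduces everything to one count: over a finite
  abelian group \<open>A\<close> the subgraph \<open>(V, S)\<close> has \<open>|Tor2 A| ^ unbal_closed * |A| ^ corank\<close> flows.

  For this count (\<open>card_int_kernel_inc\<close>), choose a root in every component and a walk from it to each
  vertex. Replacing the row of every root by the sum of the rows of its component, each with the
  sign of its walk, is an invertible row operation. It turns the incidence matrix into one whose
  columns lie in, and generate, a lattice \<open>\<Oplus> m v \<int>\<close>: the elementary divisor \<open>m v\<close> is \<open>1\<close> away from
  the roots, while at a root it is \<open>0\<close> for a balanced component, \<open>2\<close> for an unbalanced component
  without outer-edges, and \<open>1\<close> if there is an outer-edge. Hence the boundary map has an image of size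
  \<open>\<Prod>v. |m v A|\<close>, where \<open>|2 A| * |Tor2 A| = |A|\<close>, and dividing \<open>|A| ^ |S|\<close> by it gives the number of
  flows. The graph theory that enters is Harary's criterion: a graph without outer-edges has only
  positive circles iff vertices can be given signs such that every edge has the product of the signs of its ends
  (\<open>balanced_if_potential\<close>, \<open>balanced_imp_potential\<close>).

  A polynomial that counts flows is unique because the groups \<open>\<int>\<^sub>2 ^ k \<times> \<int>\<^sub>n\<close> with \<open>n\<close> odd realise
  the points \<open>(2 ^ k, 2 ^ k * n)\<close>, which no nonzero bivariate polynomial can vanish on.

  If removing \<open>e\<close> changes neither exponent, then all flows vanish at \<open>e\<close>, over every group, and the
  polynomial is zero. If no edge is of this kind, then for each \<open>e\<close> the proportion of flows over
  \<open>\<int>\<^sub>2 ^ m \<times> \<int>\<^sub>n\<close> with \<open>n = 3 ^ m\<close> that vanish at \<open>e\<close> is the \<open>m\<close>-th power of a number below \<open>1\<close>. For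
  large \<open>m\<close> such flows cannot make up all flows, so some flow is nowhere zero (\<open>nz_flow_exists\<close>).
\<close>


section \<open>Integer matrices acting on an abelian group\<close>

context comm_group begin

definition int_comb :: "'i set \<Rightarrow> ('i \<Rightarrow> int) \<Rightarrow> ('i \<Rightarrow> 'a) \<Rightarrow> 'a" where
  "int_comb I c f = (\<Otimes>i\<in>I. f i [^] c i)"

lemma int_comb_closed [simp]:
  assumes "f \<in> I \<rightarrow> carrier G" shows "int_comb I c f \<in> carrier G"
  unfolding int_comb_def using assms by (auto intro!: finprod_closed)

lemma int_comb_cong:
  assumes "\<And>i. i \<in> I \<Longrightarrow> c i = c' i" "\<And>i. i \<in> I \<Longrightarrow> f i = f' i" "f' \<in> I \<rightarrow> carrier G"
  shows "int_comb I c f = int_comb I c' f'"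
  unfolding int_comb_def using assms by (intro finprod_cong') auto

lemma int_comb_mult:
  assumes "f \<in> I \<rightarrow> carrier G" "g \<in> I \<rightarrow> carrier G"
  shows "int_comb I c (\<lambda>i. f i \<otimes> g i) = int_comb I c f \<otimes> int_comb I c g"
proof -
  have "int_comb I c (\<lambda>i. f i \<otimes> g i) = (\<Otimes>i\<in>I. f i [^] c i \<otimes> g i [^] c i)"
    unfolding int_comb_def using assms
    by (intro finprod_cong') (auto simp: int_pow_distrib Pi_iff)
  then show ?thesis
    unfolding int_comb_def using assms by (simp add: Pi_iff)
qed

lemma int_comb_add:
  assumes "f \<in> I \<rightarrow> carrier G"
  shows "int_comb I (\<lambda>i. c i + d i) f = int_comb I c f \<otimes> int_comb I d f"
proof -
  have "int_comb I (\<lambda>i. c i + d i) f = (\<Otimes>i\<in>I. f i [^] c i \<otimes> f i [^] d i)"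
    unfolding int_comb_def using assms
    by (intro finprod_cong') (auto simp: int_pow_mult Pi_iff)
  then show ?thesis
    unfolding int_comb_def using assms by (simp add: Pi_iff)
qed

lemma int_comb_zero [simp]: "int_comb I (\<lambda>i. 0) f = \<one>"
  by (simp add: int_comb_def)

lemma int_comb_insert:
  assumes "finite I" "i \<notin> I" "f \<in> insert i I \<rightarrow> carrier G"
  shows "int_comb (insert i I) c f = f i [^] c i \<otimes> int_comb I c f"
  unfolding int_comb_def using assms by (subst finprod_insert) auto

lemma int_comb_sum:
  assumes "finite J" "f \<in> I \<rightarrow> carrier G"
  shows "int_comb I (\<lambda>i. \<Sum>j\<in>J. c j i) f = (\<Otimes>j\<in>J. int_comb I (c j) f)"
  using assms(1)
proof induction
  case empty then show ?case by simp
next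
  case (insert j J)
  then show ?case using assms(2) by (simp add: int_comb_add)
qed

lemma int_comb_scale:
  assumes "finite I" "f \<in> I \<rightarrow> carrier G"
  shows "int_comb I (\<lambda>i. c i * k) f = int_comb I c f [^] (k :: int)"
  using assms
proof induction
  case empty then show ?case by (simp add: int_comb_def)
next
  case (insert i I)
  then show ?case by (auto simp: int_comb_insert int_pow_distrib int_pow_pow Pi_iff)
qed

text \<open>
  Composing two of these maps multiplies their integer matrices, so that relations between maps on
  powers of the group can be checked over \<open>\<int>\<close>.
\<close>

lemma int_comb_comp:
  assumes "finite I" "finite J" "h \<in> J \<rightarrow> carrier G"
  shows "int_comb I c (\<lambda>i. int_comb J (d i) h) = int_comb J (\<lambda>j. \<Sum>i\<in>I. d i j * c i) h"
proof -
  have "int_comb I c (\<lambda>i. int_comb J (d i) h) = (\<Otimes>i\<in>I. int_comb J (\<lambda>j. d i j * c i) h)"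
    unfolding int_comb_def [of I]
    using assms by (intro finprod_cong') (auto simp: int_comb_scale)
  then show ?thesis using assms by (simp add: int_comb_sum)
qed

lemma int_comb_single:
  assumes "finite I" "i \<in> I" "f \<in> I \<rightarrow> carrier G"
  shows "int_comb I (\<lambda>j. if j = i then k else 0) f = f i [^] k"
proof -
  obtain J where J: "I = insert i J" "i \<notin> J" using assms(2) by (metis mk_disjoint_insert)
  have "int_comb J (\<lambda>j. if j = i then k else 0) f = int_comb J (\<lambda>j. 0) f"
    using J assms by (intro int_comb_cong) auto
  then show ?thesis using J assms by (subst J(1), subst int_comb_insert) auto
qed

definition int_kernel :: "'i set \<Rightarrow> 'j set \<Rightarrow> ('j \<Rightarrow> 'i \<Rightarrow> int) \<Rightarrow> ('i \<Rightarrow> 'a) set" where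
  "int_kernel I J M = {f \<in> I \<rightarrow>\<^sub>E carrier G. \<forall>j\<in>J. int_comb I (M j) f = \<one>}"

text \<open>
  An integer relation between rows carries over to the values of the maps in any abelian group.
  Applied in both directions, this makes the kernel invariant under unimodular row operations.
\<close>

lemma int_kernel_row_operations:
  assumes "finite I" "finite J"
    and rows: "\<And>k i. k \<in> K \<Longrightarrow> i \<in> I \<Longrightarrow> N k i = (\<Sum>j\<in>J. T k j * M j i)"
  shows "int_kernel I J M \<subseteq> int_kernel I K N"
proof
  fix f assume f: "f \<in> int_kernel I J M"
  then have fI: "f \<in> I \<rightarrow> carrier G" by (auto simp: int_kernel_def)
  have "int_comb I (N k) f = \<one>" if k: "k \<in> K" for k
  proof -
    have "int_comb I (N k) f = int_comb I (\<lambda>i. \<Sum>j\<in>J. M j i * T k j) f"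
      using k rows fI by (intro int_comb_cong) (auto simp: mult.commute)
    also have "\<dots> = (\<Otimes>j\<in>J. int_comb I (M j) f [^] T k j)"
      using assms fI by (subst int_comb_sum) (auto intro!: finprod_cong' simp: int_comb_scale)
    also have "\<dots> = \<one>"
      using f by (intro finprod_one_eqI) (auto simp: int_kernel_def)
    finally show ?thesis .
  qed
  then show "f \<in> int_kernel I K N" using f by (auto simp: int_kernel_def)
qed

text \<open>
  Lagrange's theorem for the map with matrix \<open>M\<close>: each of its fibres is a translate of the kernel.
\<close>

lemma card_eq_kernel_times_image:
  assumes fin: "finite I" "finite (carrier G)"
  shows "card (I \<rightarrow>\<^sub>E carrier G) =
    card (int_kernel I J M) * card ((\<lambda>f. \<lambda>j\<in>J. int_comb I (M j) f) ` (I \<rightarrow>\<^sub>E carrier G))"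
    (is "card ?X = card ?K * card (?\<phi> ` ?X)")
proof -
  have finX: "finite ?X" using fin by (simp add: finite_PiE)
  have fibre: "card {f \<in> ?X. ?\<phi> f = y} = card ?K" if "y \<in> ?\<phi> ` ?X" for y
  proof -
    from that obtain h where h: "h \<in> ?X" "y = ?\<phi> h" by auto
    then have hI: "h \<in> I \<rightarrow> carrier G" by auto
    let ?t = "\<lambda>k. \<lambda>i\<in>I. h i \<otimes> k i"
    let ?u = "\<lambda>k. \<lambda>i\<in>I. inv (h i) \<otimes> k i"
    have cancel: "inv a \<otimes> (a \<otimes> b) = b" "a \<otimes> (inv a \<otimes> b) = b"
      if "a \<in> carrier G" "b \<in> carrier G" for a b
      using that by (simp_all add: m_assoc [symmetric])
    have comb_t: "int_comb I (M j) (?t k) = int_comb I (M j) h \<otimes> int_comb I (M j) k"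
      if "k \<in> I \<rightarrow> carrier G" for j k
      using that hI by (subst int_comb_mult [symmetric]) (auto intro!: int_comb_cong)
    have comb_u: "int_comb I (M j) (?u k) = inv (int_comb I (M j) h) \<otimes> int_comb I (M j) k"
      if "k \<in> I \<rightarrow> carrier G" for j k
    proof -
      have u: "?u k \<in> I \<rightarrow> carrier G" using that hI by auto
      have "int_comb I (M j) k = int_comb I (M j) (?t (?u k))"
        using that hI by (intro int_comb_cong) (auto simp: Pi_iff m_assoc [symmetric])
      also have "\<dots> = int_comb I (M j) h \<otimes> int_comb I (M j) (?u k)" using u by (rule comb_t)
      finally show ?thesis
        using that hI u by (metis int_comb_closed inv_solve_left)
    qed
    have "bij_betw ?t ?K {f \<in> ?X. ?\<phi> f = y}"
    proof (rule bij_betwI [where g = ?u])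
      show "?t \<in> ?K \<rightarrow> {f \<in> ?X. ?\<phi> f = y}"
      proof
        fix k assume k: "k \<in> ?K"
        then have kI: "k \<in> I \<rightarrow> carrier G" by (auto simp: int_kernel_def)
        have "?\<phi> (?t k) = ?\<phi> h"
          using k kI hI by (intro restrict_ext) (auto simp: comb_t int_kernel_def simp del: restrict_apply)
        then show "?t k \<in> {f \<in> ?X. ?\<phi> f = y}" using hI kI h by (auto simp: Pi_iff)
      qed
      show "?u \<in> {f \<in> ?X. ?\<phi> f = y} \<rightarrow> ?K"
      proof
        fix f assume f: "f \<in> {f \<in> ?X. ?\<phi> f = y}"
        then have fI: "f \<in> I \<rightarrow> carrier G" by auto
        have "int_comb I (M j) (?u f) = \<one>" if "j \<in> J" for j
        proof -
          have "?\<phi> f = ?\<phi> h" using f h by simp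
          then have "?\<phi> f j = ?\<phi> h j" by simp
          then have "int_comb I (M j) f = int_comb I (M j) h" using that by simp
          then show ?thesis using fI hI by (simp add: comb_u)
        qed
        then show "?u f \<in> ?K" using hI fI by (auto simp: int_kernel_def Pi_iff)
      qed
    next
      fix k assume "k \<in> ?K"
      then have "k i \<in> carrier G" if "i \<in> I" for i using that by (auto simp: int_kernel_def)
      moreover have "k i = undefined" if "i \<notin> I" for i
        using that \<open>k \<in> ?K\<close> by (auto simp: int_kernel_def)
      ultimately show "?u (?t k) = k"
        using hI cancel by (intro ext) (auto simp: Pi_iff)
    next
      fix f assume "f \<in> {f \<in> ?X. ?\<phi> f = y}"
      then have "f i \<in> carrier G" if "i \<in> I" for i using that by auto
      moreover have "f i = undefined" if "i \<notin> I" for i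
        using that \<open>f \<in> {f \<in> ?X. ?\<phi> f = y}\<close> by auto
      ultimately show "?t (?u f) = f"
        using hI cancel by (intro ext) (auto simp: Pi_iff)
    qed
    then show ?thesis by (rule bij_betw_same_card [symmetric])
  qed
  have "card ?X = (\<Sum>y\<in>?\<phi> ` ?X. card {f \<in> ?X. ?\<phi> f = y})"
    using sum.image_gen [OF finX, of "\<lambda>_. 1 :: nat" ?\<phi>] by simp
  also have "\<dots> = card ?K * card (?\<phi> ` ?X)" using fibre by simp
  finally show ?thesis .
qed

text \<open>
  The two hypotheses say that the columns of \<open>M\<close> span exactly the lattice \<open>\<Oplus> m j \<int>\<close>. So the image of
  the map consists of the tuples whose \<open>j\<close>-th entry is an \<open>m j\<close>-th power.
\<close>

lemma card_int_kernel_diagonal: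
  assumes fin: "finite I" "finite J" "finite (carrier G)"
    and dvd: "\<And>i j. i \<in> I \<Longrightarrow> j \<in> J \<Longrightarrow> m j dvd M j i"
    and hit: "\<And>j. j \<in> J \<Longrightarrow> \<exists>c. \<forall>j'\<in>J. (\<Sum>i\<in>I. M j' i * c i) = (if j' = j then m j else 0)"
  shows "card (int_kernel I J M) * (\<Prod>j\<in>J. card ((\<lambda>a. a [^] m j) ` carrier G))
    = card (carrier G) ^ card I"
proof -
  let ?\<phi> = "\<lambda>f. \<lambda>j\<in>J. int_comb I (M j) f"
  let ?X = "I \<rightarrow>\<^sub>E carrier G" and ?Y = "\<Pi>\<^sub>E j\<in>J. (\<lambda>a. a [^] m j) ` carrier G"
  have "?\<phi> ` ?X = ?Y"
  proof
    show "?\<phi> ` ?X \<subseteq> ?Y"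
    proof
      fix g assume "g \<in> ?\<phi> ` ?X"
      then obtain f where f: "f \<in> ?X" "g = ?\<phi> f" by auto
      have "int_comb I (M j) f \<in> (\<lambda>a. a [^] m j) ` carrier G" if "j \<in> J" for j
      proof -
        have "int_comb I (M j) f = int_comb I (\<lambda>i. M j i div m j * m j) f"
          using f dvd [OF _ that] by (intro int_comb_cong) (auto simp only: dvd_div_mult_self)
        also have "\<dots> = int_comb I (\<lambda>i. M j i div m j) f [^] m j"
          using fin f by (intro int_comb_scale) auto
        finally have "int_comb I (M j) f = int_comb I (\<lambda>i. M j i div m j) f [^] m j" .
        moreover have "int_comb I (\<lambda>i. M j i div m j) f \<in> carrier G"
          using f by (intro int_comb_closed) auto
        ultimately show ?thesis by (rule image_eqI)
      qed
      then show "g \<in> ?Y" unfolding f(2) restrict_PiE_iff by blast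
    qed
    show "?Y \<subseteq> ?\<phi> ` ?X"
    proof
      fix g assume g: "g \<in> ?Y"
      have "\<forall>j\<in>J. \<exists>a. a \<in> carrier G \<and> g j = a [^] m j" using g by blast
      then obtain h where h: "\<And>j. j \<in> J \<Longrightarrow> h j \<in> carrier G \<and> g j = h j [^] m j"
        by metis
      then have hJ: "h \<in> J \<rightarrow> carrier G" by auto
      obtain c where c: "\<And>j j'. j \<in> J \<Longrightarrow> j' \<in> J \<Longrightarrow>
          (\<Sum>i\<in>I. M j' i * c j i) = (if j' = j then m j else 0)"
        using bchoice [of J "\<lambda>j c. \<forall>j'\<in>J. (\<Sum>i\<in>I. M j' i * c i) = (if j' = j then m j else 0)"] hit
        by blast
      \<comment> \<open>Column \<open>j\<close> of \<open>c\<close> writes \<open>m j\<close> times the \<open>j\<close>-th unit vector in terms of the columns of \<open>M\<close>.\<close>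
      let ?f = "\<lambda>i\<in>I. int_comb J (\<lambda>j. c j i) h"
      have "int_comb I (M j) ?f = g j" if j: "j \<in> J" for j
      proof -
        have "int_comb I (M j) ?f = int_comb I (M j) (\<lambda>i. int_comb J (\<lambda>j. c j i) h)"
          using hJ by (intro int_comb_cong) auto
        also have "\<dots> = int_comb J (\<lambda>j'. \<Sum>i\<in>I. c j' i * M j i) h"
          using fin(1,2) hJ by (rule int_comb_comp)
        also have "\<dots> = int_comb J (\<lambda>j'. if j' = j then m j else 0) h"
          using c [OF _ j] j hJ by (intro int_comb_cong) (auto simp: mult.commute [of "c _ _"])
        also have "\<dots> = g j" using h j fin hJ by (simp add: int_comb_single)
        finally show ?thesis .
      qed
      then have "?\<phi> ?f = restrict g J" by (intro restrict_ext)
      also have "\<dots> = g" using g by (rule PiE_restrict)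
      finally have "?\<phi> ?f = g" .
      moreover have "?f \<in> ?X" using hJ by (auto intro!: int_comb_closed)
      ultimately show "g \<in> ?\<phi> ` ?X" by blast
    qed
  qed
  then show ?thesis
    using card_eq_kernel_times_image [OF fin(1,3), of J M] fin by (simp add: card_PiE)
qed

text \<open>
  Squaring is the map with the \<open>1 \<times> 1\<close> matrix \<open>2\<close>, whose kernel is the 2-torsion.
\<close>

lemma card_squares_times_Tor2:
  assumes "finite (carrier G)"
  shows "card (Tor2 G) * card ((\<lambda>a. a [^] (2::int)) ` carrier G) = card (carrier G)"
proof -
  let ?M = "\<lambda>_ _. 2 :: int" and ?U = "{()}"
  have comb: "int_comb ?U c f = f () [^] c ()" if "f () \<in> carrier G" for c f
    using that by (simp add: int_comb_def finprod_insert)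
  have pow: "a [^] (2::int) = a [^] (2::nat)" for a
    using int_pow_int [of G a 2] by simp
  have "bij_betw (\<lambda>f. f ()) (int_kernel ?U ?U ?M) (Tor2 G)"
    by (rule bij_betwI [where g = "\<lambda>a. \<lambda>_\<in>?U. a"])
      (auto simp: int_kernel_def Tor2_def comb pow PiE_iff fun_eq_iff)
  moreover have "inj_on (\<lambda>f. f ()) ((\<lambda>f. \<lambda>j\<in>?U. int_comb ?U (?M j) f) ` (?U \<rightarrow>\<^sub>E carrier G))"
    by (auto simp: inj_on_def fun_eq_iff)
  moreover have "(\<lambda>f. f ()) ` (\<lambda>f. \<lambda>j\<in>?U. int_comb ?U (?M j) f) ` (?U \<rightarrow>\<^sub>E carrier G)
      = (\<lambda>a. a [^] (2::int)) ` carrier G" (is "?L = ?R")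
  proof
    show "?L \<subseteq> ?R" by (auto simp: comb PiE_iff)
    show "?R \<subseteq> ?L"
    proof
      fix b assume "b \<in> ?R"
      then obtain a where a: "a \<in> carrier G" "b = a [^] (2::int)" by auto
      then have "(\<lambda>_\<in>?U. a) \<in> ?U \<rightarrow>\<^sub>E carrier G" by auto
      moreover have "b = (\<lambda>j\<in>?U. int_comb ?U (?M j) (\<lambda>_\<in>?U. a)) ()"
        using a by (simp add: comb)
      ultimately show "b \<in> ?L" by blast
    qed
  qed
  ultimately show ?thesis
    using card_eq_kernel_times_image [of ?U ?U ?M] assms
    by (simp add: bij_betw_same_card card_PiE card_image [symmetric])
qed

end


section \<open>Balance and potentials\<close>

lemma adjacency_sym:
  assumes "(u, v) \<in> adjacency G" shows "(v, u) \<in> adjacency G"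
proof -
  obtain e i where "e \<in> edges G" "att G e i = Some u" "att G e (\<not> i) = Some v"
    using assms by (auto simp: adjacency_def)
  then have "\<exists>i. att G e i = Some v \<and> att G e (\<not> i) = Some u" by (intro exI [of _ "\<not> i"]) simp
  with \<open>e \<in> edges G\<close> show ?thesis by (auto simp: adjacency_def)
qed

lemma adjacency_rtrancl_sym: "(u, v) \<in> (adjacency G)\<^sup>* \<Longrightarrow> (v, u) \<in> (adjacency G)\<^sup>*"
  by (meson adjacency_sym sym_def sym_rtrancl)

lemma adjacencyI:
  "e \<in> edges G \<Longrightarrow> att G e i = Some u \<Longrightarrow> att G e (\<not> i) = Some v \<Longrightarrow> (u, v) \<in> adjacency G"
  unfolding adjacency_def by auto

text \<open>
  A potential is what is usually called a switching function: switching with it makes all edges in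
  \<open>F\<close> positive. Edges with only one attached end are not constrained.
\<close>

definition potential :: "('v, 'e) sgraph \<Rightarrow> 'e set \<Rightarrow> ('v \<Rightarrow> int) \<Rightarrow> bool" where
  "potential G F p \<longleftrightarrow> (\<forall>v. p v \<in> {1, -1}) \<and>
     (\<forall>e\<in>F. \<forall>i u v. att G e i = Some u \<longrightarrow> att G e (\<not> i) = Some v \<longrightarrow> esign G e = p u * p v)"

lemma potentialD:
  "potential G F p \<Longrightarrow> e \<in> F \<Longrightarrow> att G e i = Some u \<Longrightarrow> att G e (\<not> i) = Some v \<Longrightarrow>
    esign G e = p u * p v"
  unfolding potential_def by blast

lemma potential_square: "potential G F p \<Longrightarrow> p v * p v = 1"
  unfolding potential_def by (metis insertE mult_1 mult_minus1 minus_minus singletonD)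

lemma not_outer_both_ends:
  assumes "signed_graph G" "\<not> has_outer_edge G" "e \<in> edges G"
  obtains u where "att G e i = Some u"
proof -
  have "\<exists>i. att G e i \<noteq> None" "\<not> (\<exists>!i. att G e i \<noteq> None)"
    using assms unfolding signed_graph_def has_outer_edge_def is_outer_edge_def by blast+
  then have "att G e True \<noteq> None" "att G e False \<noteq> None"
    by (metis (full_types))+
  then have "att G e i \<noteq> None" by (cases i) auto
  then show thesis using that by blast
qed

text \<open>
  In the product of the signs of a circle, every vertex contributes its sign once for each end at it,
  that is, twice.
\<close>

lemma balanced_if_potential:
  assumes p: "potential G (edges G) p" and "\<not> has_outer_edge G"
  shows "balanced G"
  unfolding balanced_def
proof (intro conjI allI impI)
  show "\<not> has_outer_edge G" by fact
next
  fix W F assume F: "F \<subseteq> edges G" and circ: "is_circle (G\<lparr>verts := W, edges := F\<rparr>)"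
  let ?H = "G\<lparr>verts := W, edges := F\<rparr>"
  let ?end = "\<lambda>(e, i). the (att G e i)"
  have H: "signed_graph ?H" "\<not> has_outer_edge ?H" and deg: "\<And>v. v \<in> W \<Longrightarrow> degree_at ?H v = 2"
    using circ unfolding is_circle_def by auto
  have fin: "finite W" "finite F" using H unfolding signed_graph_def by auto
  have ends: "\<exists>u\<in>W. att G e i = Some u" if e: "e \<in> F" for e i
  proof -
    obtain u where u: "att ?H e i = Some u" by (rule not_outer_both_ends [OF H]) (use e in simp)
    moreover have "u \<in> W" using H(1) u e unfolding signed_graph_def by auto
    ultimately show ?thesis by auto
  qed
  have "(\<Prod>e\<in>F. esign G e) = (\<Prod>e\<in>F. \<Prod>i\<in>UNIV. p (?end (e, i)))"
  proof (intro prod.cong refl)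
    fix e assume e: "e \<in> F"
    obtain u where u: "att G e True = Some u" using ends [OF e, of True] by blast
    obtain v where v: "att G e False = Some v" using ends [OF e, of False] by blast
    show "esign G e = (\<Prod>i\<in>UNIV. p (?end (e, i)))"
      using potentialD [OF p, of e True u v] u v F e by (auto simp: UNIV_bool)
  qed
  also have "\<dots> = (\<Prod>x\<in>F \<times> UNIV. p (?end x))"
    by (subst prod.cartesian_product) (auto intro: prod.cong)
  also have "\<dots> = (\<Prod>v\<in>W. \<Prod>x\<in>{x \<in> F \<times> UNIV. ?end x = v}. p (?end x))"
  proof (rule prod.group [symmetric])
    have "?end (e, i) \<in> W" if "e \<in> F" for e i using ends [OF that, of i] by auto
    then show "?end ` (F \<times> UNIV) \<subseteq> W" by auto
  qed (use fin in auto)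
  also have "\<dots> = (\<Prod>v\<in>W. 1)"
  proof (intro prod.cong refl)
    fix v assume v: "v \<in> W"
    have "?end (e, i) = v \<longleftrightarrow> att G e i = Some v" if "e \<in> F" for e i
      using ends [OF that, of i] by auto
    then have "{x \<in> F \<times> UNIV. ?end x = v} = {(e, i). e \<in> F \<and> att G e i = Some v}"
      by auto
    then have "card {x \<in> F \<times> UNIV. ?end x = v} = 2"
      using deg [OF v] by (simp add: degree_at_def)
    moreover have "(\<Prod>x\<in>{x \<in> F \<times> UNIV. ?end x = v}. p (?end x)) =
        (\<Prod>x\<in>{x \<in> F \<times> UNIV. ?end x = v}. p v)"
      by (intro prod.cong) auto
    ultimately show "(\<Prod>x\<in>{x \<in> F \<times> UNIV. ?end x = v}. p (?end x)) = 1"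
      using potential_square [OF p, of v] by (simp add: power2_eq_square)
  qed
  finally show "(\<Prod>e\<in>F. esign G e) = 1" by simp
qed

text \<open>
  A path is recorded by its vertex set \<open>W\<close> and its edge set \<open>P\<close>, since a circle is a subgraph and not
  a walk; \<open>u \<notin> W\<close> in the second rule keeps the path simple.
\<close>

inductive simple_path ::
  "('v, 'e) sgraph \<Rightarrow> 'e set \<Rightarrow> 'v set \<Rightarrow> 'e set \<Rightarrow> 'v \<Rightarrow> 'v \<Rightarrow> bool" for G F where
  trivial: "simple_path G F {u} {} u u"
| extend: "simple_path G F W P v w \<Longrightarrow> u \<notin> W \<Longrightarrow> e \<in> F \<Longrightarrow>
    att G e i = Some u \<Longrightarrow> att G e (\<not> i) = Some v \<Longrightarrow>
    simple_path G F (insert u W) (insert e P) u w"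

lemma simple_path_props:
  assumes "simple_path G F W P u w"
  shows "P \<subseteq> F" "finite P" "finite W" "u \<in> W" "w \<in> W"
    "e \<in> P \<Longrightarrow> \<exists>x\<in>W. att G e i = Some x"
proof -
  have "P \<subseteq> F \<and> finite P \<and> finite W \<and> u \<in> W \<and> w \<in> W \<and>
      (\<forall>e\<in>P. \<forall>i. \<exists>x\<in>W. att G e i = Some x)"
    using assms
  proof induction
    case (trivial u) then show ?case by simp
  next
    case (extend W P v w u e i)
    then have "\<exists>x\<in>insert u W. att G e j = Some x" for j by (cases "j = i") auto
    then show ?case using extend by blast
  qed
  then show "P \<subseteq> F" "finite P" "finite W" "u \<in> W" "w \<in> W"
    "e \<in> P \<Longrightarrow> \<exists>x\<in>W. att G e i = Some x" by auto
qed

lemma simple_path_suffix: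
  assumes "simple_path G F W P v w" "u \<in> W"
  shows "\<exists>W' P'. simple_path G F W' P' u w"
  using assms by induction (auto intro: simple_path.intros)

lemma simple_path_exists:
  assumes "(u, w) \<in> (adjacency (G\<lparr>edges := F\<rparr>))\<^sup>*"
  shows "\<exists>W P. simple_path G F W P u w"
  using assms
proof (induction rule: converse_rtrancl_induct)
  case base
  show ?case by (blast intro: simple_path.trivial)
next
  case (step u v)
  then obtain W P where WP: "simple_path G F W P v w" by blast
  obtain e i where "e \<in> F" "att G e i = Some u" "att G e (\<not> i) = Some v"
    using step(1) unfolding adjacency_def by auto
  then show ?case
    using simple_path.extend [OF WP] simple_path_suffix [OF WP] by blast
qed

definition ends_at :: "('v, 'e) sgraph \<Rightarrow> 'e set \<Rightarrow> 'v \<Rightarrow> ('e \<times> bool) set" where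
  "ends_at G P x = {(e, i). e \<in> P \<and> att G e i = Some x}"

lemma card_ends_at_insert:
  assumes "finite P" "e \<notin> P" "att G e i = Some a" "att G e (\<not> i) = Some b"
  shows "card (ends_at G (insert e P) x) =
    card (ends_at G P x) + of_bool (x = a) + of_bool (x = b)"
proof -
  let ?A = "if x = a then {(e, i)} else {}" and ?B = "if x = b then {(e, \<not> i)} else {}"
  have fin: "finite (ends_at G P x)"
    by (rule finite_subset [of _ "P \<times> UNIV"]) (use assms in \<open>auto simp: ends_at_def\<close>)
  have "ends_at G (insert e P) x = (ends_at G P x \<union> ?A) \<union> ?B"
  proof -
    have "att G e j = Some x \<longleftrightarrow> (j = i \<and> x = a) \<or> (j = (\<not> i) \<and> x = b)" for j
      using assms by (cases "j = i") auto
    then show ?thesis by (auto simp: ends_at_def)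
  qed
  also have "card \<dots> = card (ends_at G P x \<union> ?A) + card ?B"
    using fin assms by (subst card_Un_disjoint) (auto simp: ends_at_def)
  also have "card (ends_at G P x \<union> ?A) = card (ends_at G P x) + card ?A"
    using fin assms by (subst card_Un_disjoint) (auto simp: ends_at_def)
  finally show ?thesis by simp
qed

text \<open>
  Inner vertices of a path have degree 2 and its two ends have degree 1. The additive form also covers
  the trivial path, whose two ends coincide and have degree 0; so loops need no special treatment when
  a path is closed to a circle.
\<close>

lemma simple_path_degree:
  assumes "simple_path G F W P u w"
  shows "card (ends_at G P x) + of_bool (x = u) + of_bool (x = w) = 2 * of_bool (x \<in> W)"
  using assms
proof induction
  case (trivial u)
  then show ?case by (auto simp: ends_at_def)
next
  case (extend W P v w u e i)
  note props = simple_path_props [OF extend.hyps(1)]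
  have "e \<notin> P" using props(6) extend by (metis option.inject)
  then have "card (ends_at G (insert e P) x) =
      card (ends_at G P x) + of_bool (x = u) + of_bool (x = v)"
    using extend props by (intro card_ends_at_insert) auto
  then show ?case using extend.IH extend.hyps(2) props(4) by (cases "x = u") auto
qed

lemma simple_path_sign:
  assumes "simple_path G F W P u w" and p: "potential G F p"
  shows "(\<Prod>e\<in>P. esign G e) = p u * p w"
  using assms(1)
proof induction
  case (trivial u)
  then show ?case using potential_square [OF p] by simp
next
  case (extend W P v w u e i)
  note props = simple_path_props [OF extend.hyps(1)]
  have "e \<notin> P" using props(6) extend by (metis option.inject)
  then have "(\<Prod>e\<in>insert e P. esign G e) = (p u * p v) * (p v * p w)"
    using potentialD [OF p extend.hyps(3-5)] extend.IH props by simp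
  also have "\<dots> = p u * (p v * p v) * p w" by (simp only: mult.assoc)
  finally show ?case using potential_square [OF p] by simp
qed

lemma simple_path_connected:
  assumes "simple_path G F W P u w" "P \<subseteq> edges H" "att H = att G" "x \<in> W"
  shows "(x, w) \<in> (adjacency H)\<^sup>*"
  using assms
proof (induction arbitrary: x)
  case (trivial u)
  then show ?case by simp
next
  case (extend W P v w u e i)
  have "(u, v) \<in> adjacency H" using extend by (intro adjacencyI) auto
  moreover have "(v, w) \<in> (adjacency H)\<^sup>*"
    using extend.IH [of v] extend.prems simple_path_props(4) [OF extend.hyps(1)] by auto
  ultimately show ?case
    using extend by (auto intro: converse_rtrancl_into_rtrancl)
qed

text \<open>
  If \<open>u = w\<close>, the path is trivial and the circle is the loop \<open>e\<close>.
\<close>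

lemma simple_path_closes_to_circle:
  assumes G: "signed_graph G" and path: "simple_path G F W P u w" and F: "F \<subseteq> edges G"
    and W: "W \<subseteq> verts G"
    and e: "e \<in> edges G" "e \<notin> P" "att G e i = Some u" "att G e (\<not> i) = Some w"
  shows "is_circle (G\<lparr>verts := W, edges := insert e P\<rparr>)" (is "is_circle ?H")
proof -
  note props = simple_path_props [OF path]
  have ends: "\<exists>x\<in>W. att G e' j = Some x" if "e' \<in> insert e P" for e' j
    using that props(4-6) e by (cases "j = i") auto
  have "signed_graph ?H"
    unfolding signed_graph_def
  proof (intro conjI ballI allI impI)
    fix e' assume "e' \<in> edges ?H"
    then have e': "e' \<in> insert e P" by simp
    show "\<exists>i. att ?H e' i \<noteq> None" using ends [OF e', of True] by (auto intro: exI [of _ True])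
    have "e' \<in> edges G" using e' props(1) F e(1) by auto
    then show "esign ?H e' \<in> {1, -1}" using G by (simp add: signed_graph_def)
    fix j v assume "att ?H e' j = Some v"
    then show "v \<in> verts ?H" using ends [OF e', of j] by simp
  qed (use props in auto)
  moreover have "connected_graph ?H"
    unfolding connected_graph_def
  proof (intro conjI ballI)
    show "verts ?H \<noteq> {}" using props by auto
  next
    fix x y assume "x \<in> verts ?H" "y \<in> verts ?H"
    then have "(x, w) \<in> (adjacency ?H)\<^sup>*" "(y, w) \<in> (adjacency ?H)\<^sup>*"
      by (auto intro!: simple_path_connected [OF path])
    then show "(x, y) \<in> (adjacency ?H)\<^sup>*"
      by (meson adjacency_rtrancl_sym rtrancl_trans)
  qed
  moreover have "degree_at ?H v = 2" if "v \<in> W" for v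
    using card_ends_at_insert [OF props(2) e(2-4), of v] simple_path_degree [OF path, of v] that
    by (simp add: degree_at_def ends_at_def)
  moreover have "\<not> has_outer_edge ?H"
    unfolding has_outer_edge_def is_outer_edge_def using ends by simp (metis option.discI)
  ultimately show ?thesis by (simp add: is_circle_def)
qed

text \<open>
  Insert the edges one at a time. If the ends of the new edge \<open>e\<close> are already joined by a path, then
  this path and \<open>e\<close> form a positive circle, and the potential fits \<open>e\<close>. If not, the potential may be
  negated on all that is connected to one end of \<open>e\<close>.
\<close>

lemma balanced_imp_potential:
  assumes G: "signed_graph G" and bal: "balanced G"
  shows "\<exists>p. potential G (edges G) p"
proof -
  have outer: "\<not> has_outer_edge G" using bal by (simp add: balanced_def)
  have "F \<subseteq> edges G \<longrightarrow> (\<exists>p. potential G F p)" if "finite F" for F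
    using that
  proof induction
    case empty
    show ?case by (auto simp: potential_def)
  next
    case (insert e F)
    show ?case
    proof
      assume sub: "insert e F \<subseteq> edges G"
      then obtain p where p: "potential G F p" using insert.IH by auto
      obtain u where u: "att G e True = Some u"
        by (rule not_outer_both_ends [OF G outer]) (use sub in auto)
      obtain w where w: "att G e False = Some w"
        by (rule not_outer_both_ends [OF G outer]) (use sub in auto)
      have new: "potential G (insert e F) q" if q: "potential G F q" "esign G e = q u * q w" for q
        unfolding potential_def
      proof (intro conjI ballI allI impI)
        fix v show "q v \<in> {1, -1}" using q by (simp add: potential_def)
      next
        fix e' i a b
        assume e': "e' \<in> insert e F" "att G e' i = Some a" "att G e' (\<not> i) = Some b"
        show "esign G e' = q a * q b"
        proof (cases "e' = e")
          case True
          then show ?thesis using e' u w q(2) by (cases i) auto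
        next
          case False
          then show ?thesis using e' potentialD [OF q(1)] by auto
        qed
      qed
      have p1: "p v \<in> {1, -1}" for v using p by (simp add: potential_def)
      have es: "esign G e \<in> {1, -1}" using G sub by (simp add: signed_graph_def)
      let ?R = "(adjacency (G\<lparr>edges := F\<rparr>))\<^sup>*"
      show "\<exists>q. potential G (insert e F) q"
      proof (cases "(u, w) \<in> ?R")
        case True
        then obtain W P where WP: "simple_path G F W P u w"
          using simple_path_exists [OF True] by blast
        note props = simple_path_props [OF WP]
        have W: "W \<subseteq> verts G"
        proof
          fix x assume "x \<in> W"
          then have "(x, w) \<in> ?R" by (rule simple_path_connected [OF WP, rotated -1]) (use props in auto)
          then show "x \<in> verts G"
          proof (cases rule: converse_rtranclE)
            case base
            then show ?thesis using w G sub by (auto simp: signed_graph_def)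
          next
            case (step y)
            then show ?thesis using G sub by (auto simp: signed_graph_def adjacency_def)
          qed
        qed
        have eP: "e \<notin> P" using props insert.hyps by auto
        have "is_circle (G\<lparr>verts := W, edges := insert e P\<rparr>)"
          using sub u w by (intro simple_path_closes_to_circle [OF G WP _ W _ eP, of True]) auto
        then have "(\<Prod>e\<in>insert e P. esign G e) = 1"
          using bal W props sub unfolding balanced_def by (metis insert_subset order_trans)
        then have "esign G e * (p u * p w) = 1"
          using eP props simple_path_sign [OF WP p] by simp
        then have "esign G e = p u * p w" using es by auto
        then show ?thesis using new p by blast
      next
        case False
        define q where "q = (\<lambda>x. if (u, x) \<in> ?R then - p x else p x)"
        have q: "potential G F q"
          unfolding potential_def
        proof (intro conjI ballI allI impI)
          fix v show "q v \<in> {1, -1}" using p1 [of v] by (auto simp: q_def)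
        next
          fix e' i a b assume e': "e' \<in> F" "att G e' i = Some a" "att G e' (\<not> i) = Some b"
          then have ab: "(a, b) \<in> adjacency (G\<lparr>edges := F\<rparr>)" by (intro adjacencyI) auto
          then have "(b, a) \<in> adjacency (G\<lparr>edges := F\<rparr>)" by (rule adjacency_sym)
          then have "(u, a) \<in> ?R \<longleftrightarrow> (u, b) \<in> ?R" using ab by (meson rtrancl.rtrancl_into_rtrancl)
          then show "esign G e' = q a * q b" using potentialD [OF p e'] by (auto simp: q_def)
        qed
        have "q u * q w = - (p u * p w)" using False by (simp add: q_def)
        moreover have "esign G e = p u * p w \<or> esign G e = - (p u * p w)"
          using es p1 [of u] p1 [of w] by auto
        ultimately show ?thesis using new p q by metis
      qed
    qed
  qed
  then show ?thesis using G by (simp add: signed_graph_def)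
qed


section \<open>Roots of components and signs of walks\<close>

text \<open>
  The choice depends only on the set of vertices that \<open>v\<close> is connected to, so it is the same for all
  vertices of a component.
\<close>

definition comp_root :: "('v, 'e) sgraph \<Rightarrow> 'v \<Rightarrow> 'v" where
  "comp_root G v = (SOME w. w \<in> verts G \<and> (v, w) \<in> (adjacency G)\<^sup>*)"

definition comp_roots :: "('v, 'e) sgraph \<Rightarrow> 'v set" where
  "comp_roots G = comp_root G ` verts G"

lemma root_props:
  assumes "v \<in> verts G"
  shows "comp_root G v \<in> verts G" "(v, comp_root G v) \<in> (adjacency G)\<^sup>*"
proof -
  have "v \<in> verts G \<and> (v, v) \<in> (adjacency G)\<^sup>*" using assms by simp
  then have "comp_root G v \<in> verts G \<and> (v, comp_root G v) \<in> (adjacency G)\<^sup>*"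
    unfolding comp_root_def by (rule someI)
  then show "comp_root G v \<in> verts G" "(v, comp_root G v) \<in> (adjacency G)\<^sup>*" by auto
qed

lemma root_cong: "(v, w) \<in> (adjacency G)\<^sup>* \<Longrightarrow> comp_root G v = comp_root G w"
  unfolding comp_root_def
  by (rule arg_cong [where f = Eps]) (auto simp: fun_eq_iff intro: rtrancl_trans adjacency_rtrancl_sym)

lemma root_eq_iff:
  "v \<in> verts G \<Longrightarrow> w \<in> verts G \<Longrightarrow> comp_root G v = comp_root G w \<longleftrightarrow> (v, w) \<in> (adjacency G)\<^sup>*"
  by (metis root_cong root_props(2) adjacency_rtrancl_sym rtrancl_trans)

lemma root_in_roots: "v \<in> verts G \<Longrightarrow> comp_root G v \<in> comp_roots G"
  by (simp add: comp_roots_def)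

lemma root_of_root: "r \<in> comp_roots G \<Longrightarrow> r \<in> verts G \<and> comp_root G r = r"
  unfolding comp_roots_def using root_props root_cong by fastforce

lemma component_of_simps [simp]:
  "att (component_of G v) = att G" "esign (component_of G v) = esign G"
  "verts (component_of G v) = {w \<in> verts G. (v, w) \<in> (adjacency G)\<^sup>*}"
  by (simp_all add: component_of_def Let_def)

lemma edges_component_of:
  "edges (component_of G v) =
    {e \<in> edges G. \<exists>i w. w \<in> verts G \<and> (v, w) \<in> (adjacency G)\<^sup>* \<and> att G e i = Some w}"
  by (auto simp: component_of_def Let_def)

lemma component_of_cong:
  assumes "(v, w) \<in> (adjacency G)\<^sup>*" shows "component_of G v = component_of G w"
proof -
  have "(v, x) \<in> (adjacency G)\<^sup>* \<longleftrightarrow> (w, x) \<in> (adjacency G)\<^sup>*" for x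
    using assms by (meson adjacency_rtrancl_sym rtrancl_trans)
  then show ?thesis by (simp add: component_of_def)
qed

lemma components_eq_roots: "components G = component_of G ` comp_roots G"
  unfolding components_def comp_roots_def image_image
  by (intro image_cong refl component_of_cong root_props)

lemma inj_on_component_of_roots: "inj_on (component_of G) (comp_roots G)"
proof
  fix r r' assume r: "r \<in> comp_roots G" "r' \<in> comp_roots G" and eq: "component_of G r = component_of G r'"
  have "r \<in> verts (component_of G r)" using root_of_root [OF r(1)] by simp
  then have "(r', r) \<in> (adjacency G)\<^sup>*" unfolding eq by simp
  then show "r = r'" using root_cong root_of_root r by metis
qed

lemma card_components:
  "card {H \<in> components G. P H} = card {r \<in> comp_roots G. P (component_of G r)}"
proof -
  have "{H \<in> components G. P H} = component_of G ` {r \<in> comp_roots G. P (component_of G r)}"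
    unfolding components_eq_roots by auto
  also have "card \<dots> = card {r \<in> comp_roots G. P (component_of G r)}"
    by (rule card_image) (auto intro: inj_on_subset [OF inj_on_component_of_roots])
  finally show ?thesis .
qed

inductive signed_walk :: "('v, 'e) sgraph \<Rightarrow> 'v \<Rightarrow> 'v \<Rightarrow> int \<Rightarrow> bool" for G u where
  trivial: "signed_walk G u u 1"
| extend: "signed_walk G u v s \<Longrightarrow> e \<in> edges G \<Longrightarrow> att G e i = Some v \<Longrightarrow>
    att G e (\<not> i) = Some w \<Longrightarrow> signed_walk G u w (s * esign G e)"

lemma signed_walk_exists:
  assumes "(u, v) \<in> (adjacency G)\<^sup>*" shows "\<exists>s. signed_walk G u v s"
  using assms
proof induction
  case base
  show ?case by (blast intro: signed_walk.trivial)
next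
  case (step v w)
  then show ?case unfolding adjacency_def by (auto intro: signed_walk.extend)
qed

lemma signed_walk_sign:
  assumes "signed_walk G u v s" "signed_graph G" shows "s \<in> {1, -1}"
  using assms by (induction) (auto simp: signed_graph_def)

text \<open>
  In an unbalanced component the sign depends on the chosen walk, and any choice will do. At the root
  itself the trivial walk is forced, as the row operation below needs the coefficient \<open>1\<close> there.
\<close>

definition walk_sign :: "('v, 'e) sgraph \<Rightarrow> 'v \<Rightarrow> int" where
  "walk_sign G v = (if v = comp_root G v then 1 else SOME s. signed_walk G (comp_root G v) v s)"

lemma signed_walk_walk_sign:
  assumes "v \<in> verts G" shows "signed_walk G (comp_root G v) v (walk_sign G v)"
proof (cases "v = comp_root G v")
  case True
  then show ?thesis using signed_walk.trivial [of G v] by (simp add: walk_sign_def)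
next
  case False
  have "\<exists>s. signed_walk G (comp_root G v) v s"
    by (rule signed_walk_exists [OF adjacency_rtrancl_sym [OF root_props(2) [OF assms]]])
  then show ?thesis using False by (auto simp: walk_sign_def intro: someI_ex)
qed

lemma walk_sign_root: "r \<in> comp_roots G \<Longrightarrow> walk_sign G r = 1"
  by (simp add: walk_sign_def root_of_root)


section \<open>The incidence matrix and its column lattice\<close>

text \<open>
  The incidence matrix for the orientation in which the arrow at the end \<open>True\<close> points outwards. A
  negative loop gets the entry \<open>2\<close> and a positive loop the entry \<open>0\<close>, because both ends are added up.
\<close>

definition inc :: "('v, 'e) sgraph \<Rightarrow> 'v \<Rightarrow> 'e \<Rightarrow> int" where
  "inc G v e = of_bool (att G e True = Some v) - of_bool (att G e False = Some v) * esign G e"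

text \<open>
  The integer span of the columns of the incidence matrix.
\<close>

definition boundary_lattice :: "('v, 'e) sgraph \<Rightarrow> ('v \<Rightarrow> int) set" where
  "boundary_lattice G = {k. \<exists>c. \<forall>v\<in>verts G. (\<Sum>e\<in>edges G. inc G v e * c e) = k v}"

lemma boundary_lattice_add:
  assumes "k \<in> boundary_lattice G" "l \<in> boundary_lattice G"
  shows "(\<lambda>v. k v + l v) \<in> boundary_lattice G"
proof -
  obtain c d where "\<forall>v\<in>verts G. (\<Sum>e\<in>edges G. inc G v e * c e) = k v"
    "\<forall>v\<in>verts G. (\<Sum>e\<in>edges G. inc G v e * d e) = l v"
    using assms by (auto simp: boundary_lattice_def)
  then have "\<forall>v\<in>verts G. (\<Sum>e\<in>edges G. inc G v e * (c e + d e)) = k v + l v"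
    by (simp add: distrib_left sum.distrib)
  then show ?thesis by (auto simp: boundary_lattice_def)
qed

lemma boundary_lattice_scale:
  assumes "k \<in> boundary_lattice G" shows "(\<lambda>v. n * k v) \<in> boundary_lattice G"
proof -
  obtain c where "\<forall>v\<in>verts G. (\<Sum>e\<in>edges G. inc G v e * c e) = k v"
    using assms by (auto simp: boundary_lattice_def)
  then have "\<forall>v\<in>verts G. (\<Sum>e\<in>edges G. inc G v e * (n * c e)) = n * k v"
    by (simp add: mult.left_commute [of _ n] sum_distrib_left [symmetric])
  then show ?thesis by (auto simp: boundary_lattice_def)
qed

lemma boundary_lattice_inc:
  assumes "finite (edges G)" "e \<in> edges G"
  shows "(\<lambda>v. inc G v e) \<in> boundary_lattice G"
proof -
  have "\<forall>v\<in>verts G. (\<Sum>e'\<in>edges G. inc G v e' * of_bool (e' = e)) = inc G v e"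
    using assms by (simp add: sum.delta' of_bool_def if_distrib cong: if_cong)
  then show ?thesis unfolding boundary_lattice_def by (intro CollectI exI)
qed

abbreviation ind :: "'v \<Rightarrow> 'v \<Rightarrow> int" where
  "ind v x \<equiv> of_bool (x = v)"

lemma esign_square: "signed_graph G \<Longrightarrow> e \<in> edges G \<Longrightarrow> esign G e * esign G e = 1"
  unfolding signed_graph_def by auto

lemma inc_link:
  assumes "signed_graph G" "e \<in> edges G" "att G e i = Some u" "att G e (\<not> i) = Some v"
  shows "inc G x e = (if i then 1 else - esign G e) * (ind u x - esign G e * ind v x)"
  using assms esign_square [OF assms(1,2)]
  by (cases i) (auto simp: inc_def algebra_simps)

text \<open>
  Along an edge, a unit at one end may be traded for a unit at the other end, with the sign of the
  edge; the whole walk collects the product of these signs.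
\<close>

lemma signed_walk_boundary:
  assumes "signed_walk G u v s" and G: "signed_graph G"
  shows "(\<lambda>x. ind v x - s * ind u x) \<in> boundary_lattice G"
  using assms(1)
proof induction
  case trivial
  show ?case by (auto simp: boundary_lattice_def intro: exI [of _ "\<lambda>_. 0"])
next
  case (extend v s e i w)
  have fin: "finite (edges G)" using G by (simp add: signed_graph_def)
  define n where "n = (if i then - esign G e else 1)"
  have "n * inc G x e = (esign G e * esign G e) * ind w x - esign G e * ind v x" for x
    unfolding inc_link [OF G extend.hyps(2-4)] by (cases i) (simp_all add: n_def algebra_simps)
  then have "ind w x - s * esign G e * ind u x =
      n * inc G x e + esign G e * (ind v x - s * ind u x)" for x
    using esign_square [OF G extend.hyps(2)] by (simp add: algebra_simps)
  then show ?case
    using boundary_lattice_add [OF boundary_lattice_scale boundary_lattice_scale,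
      OF boundary_lattice_inc [OF fin extend.hyps(2)] extend.IH, of n "esign G e"] by simp
qed


section \<open>Balanced components in terms of walk signs\<close>

lemma att_in_verts: "signed_graph G \<Longrightarrow> e \<in> edges G \<Longrightarrow> att G e i = Some v \<Longrightarrow> v \<in> verts G"
  unfolding signed_graph_def by blast

lemma root_ends:
  "e \<in> edges G \<Longrightarrow> att G e i = Some u \<Longrightarrow> att G e (\<not> i) = Some v \<Longrightarrow> comp_root G u = comp_root G v"
  by (intro root_cong r_into_rtrancl adjacencyI)

lemma edge_in_component:
  assumes "signed_graph G" "r \<in> comp_roots G"
  shows "e \<in> edges (component_of G r) \<longleftrightarrow>
    e \<in> edges G \<and> (\<exists>i v. att G e i = Some v \<and> comp_root G v = r)"
proof -
  have "v \<in> verts G \<Longrightarrow> (r, v) \<in> (adjacency G)\<^sup>* \<longleftrightarrow> comp_root G v = r" for v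
    using root_eq_iff [of r G v] root_of_root [OF assms(2)] by auto
  then show ?thesis
    using att_in_verts [OF assms(1)] unfolding edges_component_of by blast
qed

lemma signed_graph_component_of:
  assumes G: "signed_graph G" and r: "r \<in> comp_roots G"
  shows "signed_graph (component_of G r)"
proof -
  have "w \<in> verts G \<and> (r, w) \<in> (adjacency G)\<^sup>*"
    if e: "e \<in> edges (component_of G r)" "att G e j = Some w" for e j w
  proof -
    obtain i v where iv: "att G e i = Some v" "comp_root G v = r" "e \<in> edges G"
      using e edge_in_component [OF G r] by auto
    have "comp_root G w = r"
      using root_ends [of e G i v w] iv e(2) by (cases "j = i") auto
    then show ?thesis
      using att_in_verts [OF G iv(3) e(2)] root_props(2) [of w G] adjacency_rtrancl_sym by fastforce
  qed
  moreover have "edges (component_of G r) \<subseteq> edges G" by (auto simp: edges_component_of)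
  ultimately show ?thesis
    using G unfolding signed_graph_def component_of_simps mem_Collect_eq
    by (intro conjI) (blast intro: finite_subset)+
qed

text \<open>
  With a potential, the sign of a walk depends only on its two ends.
\<close>

lemma signed_walk_potential:
  assumes "signed_walk G u v s" and p: "potential G (edges (component_of G r)) p"
    and G: "signed_graph G" "r \<in> comp_roots G" and u: "comp_root G u = r"
  shows "comp_root G v = r \<and> s = p u * p v"
  using assms(1)
proof induction
  case trivial
  then show ?case using u potential_square [OF p] by simp
next
  case (extend v s e i w)
  have "e \<in> edges (component_of G r)" using extend edge_in_component [OF G] by auto
  then have "esign G e = p v * p w" using potentialD [OF p] extend by auto
  then have "s * esign G e = p u * (p v * p v) * p w" using extend.IH by (simp only: mult.assoc)
  then show ?case
    using extend root_ends [OF extend.hyps(2-4)] potential_square [OF p] by simp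
qed

text \<open>
  Harary's criterion, with the potential replaced by the signs of the chosen walks: up to a global
  sign these are the only candidates for a potential.
\<close>

lemma balanced_component_iff:
  assumes G: "signed_graph G" and r: "r \<in> comp_roots G"
  shows "balanced (component_of G r) \<longleftrightarrow> \<not> has_outer_edge (component_of G r) \<and>
    (\<forall>e\<in>edges (component_of G r). \<forall>i u v. att G e i = Some u \<longrightarrow> att G e (\<not> i) = Some v \<longrightarrow>
       esign G e = walk_sign G u * walk_sign G v)"
    (is "?L \<longleftrightarrow> ?R")
proof
  assume L: ?L
  obtain p where "potential (component_of G r) (edges (component_of G r)) p"
    using balanced_imp_potential [OF signed_graph_component_of [OF G r] L] by blast
  then have p: "potential G (edges (component_of G r)) p" by (simp add: potential_def)
  have walk: "walk_sign G v = p r * p v" if "v \<in> verts G" "comp_root G v = r" for v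
    using signed_walk_potential [OF signed_walk_walk_sign [OF that(1)] p G r] that
      root_of_root [OF r] by simp
  have "esign G e = walk_sign G u * walk_sign G v"
    if e: "e \<in> edges (component_of G r)" "att G e i = Some u" "att G e (\<not> i) = Some v" for e i u v
  proof -
    obtain j w where jw: "att G e j = Some w" "comp_root G w = r" "e \<in> edges G"
      using e edge_in_component [OF G r] by auto
    have "comp_root G u = comp_root G v" using jw e by (intro root_ends)
    moreover have "w = u \<or> w = v" using jw(1) e by (cases "j = i") auto
    ultimately have "walk_sign G u = p r * p u" "walk_sign G v = p r * p v"
      using jw(2) walk att_in_verts [OF G jw(3)] e by auto
    then have "walk_sign G u * walk_sign G v = p r * p r * (p u * p v)" by simp
    then show ?thesis using potentialD [OF p e] potential_square [OF p] by simp
  qed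
  then show ?R using L by (auto simp: balanced_def)
next
  assume R: ?R
  \<comment> \<open>A potential has values \<open>1\<close> and \<open>-1\<close> on the whole type.\<close>
  let ?p = "\<lambda>v. if v \<in> verts G then walk_sign G v else 1"
  have sign: "walk_sign G v \<in> {1, -1}" if "v \<in> verts G" for v
    using signed_walk_sign [OF signed_walk_walk_sign [OF that] G] .
  have "potential (component_of G r) (edges (component_of G r)) ?p"
    unfolding potential_def
  proof (intro conjI ballI allI impI)
    fix v show "?p v \<in> {1, -1}" using sign [of v] by auto
  next
    fix e i u v assume e: "e \<in> edges (component_of G r)" "att (component_of G r) e i = Some u"
      "att (component_of G r) e (\<not> i) = Some v"
    then have "e \<in> edges G" by (simp add: edges_component_of)
    then have "u \<in> verts G" "v \<in> verts G" using e att_in_verts [OF G] by auto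
    moreover have "esign G e = walk_sign G u * walk_sign G v" using R e by simp
    ultimately show "esign (component_of G r) e = ?p u * ?p v" by simp
  qed
  then show ?L using R by (intro balanced_if_potential) auto
qed


section \<open>Diagonalising the incidence matrix\<close>

text \<open>
  The matrix of the row operation: row \<open>v\<close> is kept unless \<open>v\<close> is a root, and a root gets the sum of all
  rows of its component, multiplied by the signs of their walks.
\<close>

definition switch_rows :: "('v, 'e) sgraph \<Rightarrow> 'v \<Rightarrow> 'v \<Rightarrow> int" where
  "switch_rows G v w =
    (if v \<in> comp_roots G then of_bool (comp_root G w = v) * walk_sign G w else of_bool (w = v))"

definition reduced_inc :: "('v, 'e) sgraph \<Rightarrow> 'v \<Rightarrow> 'e \<Rightarrow> int" where
  "reduced_inc G v e = (\<Sum>w\<in>verts G. switch_rows G v w * inc G w e)"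

text \<open>
  The nonzero values are the elementary divisors of the incidence matrix over \<open>\<int>\<close>, and the number of
  zeros is the defect of its rank from the number of vertices.
\<close>

definition elementary_divisor :: "('v, 'e) sgraph \<Rightarrow> 'v \<Rightarrow> int" where
  "elementary_divisor G v =
    (if v \<notin> comp_roots G then 1
     else if balanced (component_of G v) then 0
     else if has_outer_edge (component_of G v) then 1 else 2)"

lemma finite_verts: "signed_graph G \<Longrightarrow> finite (verts G)"
  and finite_edges: "signed_graph G \<Longrightarrow> finite (edges G)"
  by (simp_all add: signed_graph_def)

lemma comp_roots_subset: "comp_roots G \<subseteq> verts G"
  using root_of_root [of _ G] by (intro subsetI) blast

lemma sum_ind:
  assumes "finite V" "v \<in> V"
  shows "(\<Sum>w\<in>V. f w * ind v w) = (f v :: int)" "(\<Sum>w\<in>V. ind v w * f w) = f v"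
  using assms by (simp_all add: of_bool_def if_distrib if_distribR sum.delta' sum.delta cong: if_cong)

lemma reduced_inc_nonroot:
  assumes "signed_graph G" "v \<in> verts G" "v \<notin> comp_roots G"
  shows "reduced_inc G v e = inc G v e"
  unfolding reduced_inc_def using assms
  by (simp add: switch_rows_def sum_ind finite_verts del: of_bool_eq)

lemma sum_inc:
  assumes "finite V" and V: "\<And>i v. att G e i = Some v \<Longrightarrow> v \<in> V"
  shows "(\<Sum>w\<in>V. f w * inc G w e) =
    (case att G e True of None \<Rightarrow> 0 | Some u \<Rightarrow> f u) -
    (case att G e False of None \<Rightarrow> 0 | Some u \<Rightarrow> f u) * esign G e"
proof -
  have *: "(\<Sum>w\<in>V. f w * of_bool (att G e i = Some w)) =
      (case att G e i of None \<Rightarrow> 0 | Some u \<Rightarrow> f u)" for i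
  proof (cases "att G e i")
    case (Some u)
    then have "u \<in> V" using V by blast
    have "(\<Sum>w\<in>V. f w * of_bool (att G e i = Some w)) = (\<Sum>w\<in>V. f w * ind u w)"
      using Some by (intro sum.cong) auto
    then show ?thesis using Some sum_ind(1) [OF assms(1) \<open>u \<in> V\<close>] by simp
  qed simp
  have "(\<Sum>w\<in>V. f w * inc G w e) = (\<Sum>w\<in>V. f w * of_bool (att G e True = Some w)) -
      (\<Sum>w\<in>V. f w * of_bool (att G e False = Some w)) * esign G e"
    unfolding inc_def by (simp add: right_diff_distrib sum_subtractf sum_distrib_right mult.assoc)
  then show ?thesis unfolding * .
qed

text \<open>
  An edge contributes \<open>0\<close> to the new row of the root if its sign agrees with the walk signs of its
  ends, and \<open>2\<close> or \<open>-2\<close> if it does not.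
\<close>

lemma reduced_inc_link:
  assumes G: "signed_graph G" "e \<in> edges G" and r: "r \<in> comp_roots G"
    and uv: "att G e True = Some u" "att G e False = Some v"
  shows "reduced_inc G r e =
    (if comp_root G u = r then walk_sign G u - walk_sign G v * esign G e else 0)"
proof -
  have "comp_root G u = comp_root G v" using root_ends [of e G True u v] uv G by simp
  then show ?thesis
    unfolding reduced_inc_def using r uv att_in_verts [OF G]
    by (subst sum_inc) (auto simp: switch_rows_def finite_verts G)
qed

lemma elementary_divisor_dvd:
  assumes G: "signed_graph G" and e: "e \<in> edges G" and v: "v \<in> verts G"
  shows "elementary_divisor G v dvd reduced_inc G v e"
proof (cases "v \<in> comp_roots G \<and> \<not> (\<not> balanced (component_of G v) \<and> has_outer_edge (component_of G v))")
  case False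
  then show ?thesis by (auto simp: elementary_divisor_def)
next
  case True
  then have r: "v \<in> comp_roots G" and outer: "\<not> has_outer_edge (component_of G v)"
    by (auto simp: balanced_def)
  show ?thesis
  proof (cases "e \<in> edges (component_of G v)")
    case False
    then have "comp_root G w \<noteq> v" if "att G e i = Some w" for i w
      using that e edge_in_component [OF G r] by auto
    then have "reduced_inc G v e = 0"
      unfolding reduced_inc_def using r att_in_verts [OF G e]
      by (subst sum_inc) (auto simp: switch_rows_def finite_verts G split: option.splits)
    then show ?thesis by simp
  next
    case e': True
    note H = signed_graph_component_of [OF G r]
    obtain u where u: "att G e True = Some u" using not_outer_both_ends [OF H outer e'] by auto
    obtain w where w: "att G e False = Some w" using not_outer_both_ends [OF H outer e'] by auto
    have red: "reduced_inc G v e \<in> {0, walk_sign G u - walk_sign G w * esign G e}"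
      using reduced_inc_link [OF G e r u w] by simp
    have sign: "walk_sign G u \<in> {1, -1}" "walk_sign G w \<in> {1, -1}" "esign G e \<in> {1, -1}"
      using signed_walk_sign [OF signed_walk_walk_sign G] att_in_verts [OF G e] u w G e
      by (auto simp: signed_graph_def)
    show ?thesis
    proof (cases "balanced (component_of G v)")
      case True
      then have "\<forall>i u v. att G e i = Some u \<longrightarrow> att G e (\<not> i) = Some v \<longrightarrow>
          esign G e = walk_sign G u * walk_sign G v"
        using balanced_component_iff [OF G r] e' by blast
      from this [rule_format, of True u w] have "esign G e = walk_sign G u * walk_sign G w"
        using u w by simp
      then have "reduced_inc G v e = 0" using red sign by auto
      then show ?thesis by simp
    next
      case False
      have "2 dvd reduced_inc G v e" using red sign by auto
      then show ?thesis using False r outer by (simp add: elementary_divisor_def)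
    qed
  qed
qed

text \<open>
  A unit at an end of an edge can be moved to the root. An outer-edge therefore yields a unit at the
  root, and an edge whose sign disagrees with the walk signs of its two ends yields twice a unit.
\<close>

lemma ind_root_boundary:
  assumes G: "signed_graph G" and r: "r \<in> comp_roots G" and "m = elementary_divisor G r"
  shows "(\<lambda>x. m * ind r x) \<in> boundary_lattice G"
proof (cases "balanced (component_of G r)")
  case True
  then show ?thesis
    using assms by (auto simp: elementary_divisor_def boundary_lattice_def intro: exI [of _ "\<lambda>_. 0"])
next
  case unbal: False
  have fin: "finite (edges G)" using G by (simp add: signed_graph_def)
  have to_root: "(\<lambda>x. ind u x - walk_sign G u * ind r x) \<in> boundary_lattice G"
    if "u \<in> verts G" "comp_root G u = r" for u
    using signed_walk_boundary [OF signed_walk_walk_sign [OF that(1)] G] that by simp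
  show ?thesis
  proof (cases "has_outer_edge (component_of G r)")
    case True
    then obtain e where e: "e \<in> edges (component_of G r)" and out: "\<exists>!i. att G e i \<noteq> None"
      by (auto simp: has_outer_edge_def is_outer_edge_def)
    then obtain i u where u: "att G e i = Some u" "comp_root G u = r" "e \<in> edges G"
      using edge_in_component [OF G r] by auto
    then have None: "att G e (\<not> i) = None" using out by (metis option.discI)
    have uV: "u \<in> verts G" using att_in_verts [OF G u(3,1)] .
    define n where "n = (if i then 1 else - esign G e)"
    define s where "s = walk_sign G u"
    have s: "s * s = 1" "n * n = 1"
      using signed_walk_sign [OF signed_walk_walk_sign [OF uV] G] esign_square [OF G u(3)]
      by (auto simp: s_def n_def)
    have inc: "inc G x e = n * ind u x" for x
      using u None by (cases i) (auto simp: inc_def n_def)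
    \<comment> \<open>The column of \<open>e\<close> is a unit at \<open>u\<close> up to sign; the second summand moves it to the root.\<close>
    have "s * n * inc G x e + (- s) * (ind u x - s * ind r x) = ind r x" for x
    proof -
      have "s * n * inc G x e + (- s) * (ind u x - s * ind r x) =
          s * (n * n) * ind u x - s * ind u x + (s * s) * ind r x"
        unfolding inc by (simp only: algebra_simps)
      then show ?thesis using s by simp
    qed
    then have "(\<lambda>x. ind r x) \<in> boundary_lattice G"
      using boundary_lattice_add [OF boundary_lattice_scale boundary_lattice_scale,
        OF boundary_lattice_inc [OF fin u(3)] to_root [OF uV u(2)], of "s * n" "- s"]
      by (simp add: s_def)
    then show ?thesis using assms unbal True by (simp add: elementary_divisor_def)
  next
    case False
    then obtain e i u v where e: "e \<in> edges (component_of G r)"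
      and uv: "att G e i = Some u" "att G e (\<not> i) = Some v"
      and ne: "esign G e \<noteq> walk_sign G u * walk_sign G v"
      using unbal balanced_component_iff [OF G r] by auto
    obtain j w where jw: "att G e j = Some w" "comp_root G w = r" and eG: "e \<in> edges G"
      using e edge_in_component [OF G r] by auto
    have "comp_root G u = comp_root G v" using uv eG by (intro root_ends)
    moreover have "w = u \<or> w = v" using jw(1) uv by (cases "j = i") auto
    ultimately have root: "comp_root G u = r" "comp_root G v = r" using jw(2) by auto
    have V: "u \<in> verts G" "v \<in> verts G" using att_in_verts [OF G eG] uv by auto
    define n where "n = (if i then 1 else - esign G e)"
    define s where "s = walk_sign G u"
    define t where "t = walk_sign G v"
    define z where "z = esign G e"
    have sign: "s \<in> {1, -1}" "t \<in> {1, -1}" "z \<in> {1, -1}" "n \<in> {1, -1}"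
      using signed_walk_sign [OF signed_walk_walk_sign G] V eG G
      by (auto simp: s_def t_def z_def n_def signed_graph_def)
    have "z \<noteq> s * t" using ne by (simp add: s_def t_def z_def)
    then have zst: "z = - (s * t)" using sign by auto
    have sq: "s * s = 1" "t * t = 1" "n * n = 1" using sign by auto
    have inc: "inc G x e = n * (ind u x - z * ind v x)" for x
      unfolding n_def z_def by (rule inc_link [OF G eG uv])
    \<comment> \<open>Both units of the column of \<open>e\<close> are moved to the root, where they add up since \<open>z = - s * t\<close>.\<close>
    have "s * n * inc G x e + ((- s) * (ind u x - s * ind r x) + (s * z) * (ind v x - t * ind r x))
        = 2 * ind r x" for x
    proof -
      have inc: "inc G x e = n * (ind u x - z * ind v x)" for x
      unfolding n_def z_def by (rule inc_link [OF G eG uv])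
    have "s * n * inc G x e + ((- s) * (ind u x - s * ind r x) + (s * z) * (ind v x - t * ind r x))
        = s * (n * n) * (ind u x - z * ind v x) - s * (ind u x - z * ind v x)
          + (s * s - z * s * t) * ind r x"
        unfolding inc by (simp only: algebra_simps)
      also have "z * s * t = - 1" using sign zst by auto
      finally show ?thesis using sq by simp
    qed
    then have "(\<lambda>x. 2 * ind r x) \<in> boundary_lattice G"
      using boundary_lattice_add [OF boundary_lattice_scale
          boundary_lattice_add [OF boundary_lattice_scale boundary_lattice_scale],
        OF boundary_lattice_inc [OF fin eG] to_root [OF V(1) root(1)] to_root [OF V(2) root(2)],
        of "s * n" "- s" "s * z"]
      by (simp add: s_def t_def)
    then show ?thesis using assms unbal False by (simp add: elementary_divisor_def)
  qed
qed

text \<open>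
  The row operation maps lattice vectors of the incidence matrix to lattice vectors of the reduced
  matrix. At a root it fixes the multiple of the unit vector found above; at another vertex \<open>v\<close>, it
  sends the difference between \<open>v\<close> and its root to the unit vector at \<open>v\<close>.
\<close>

lemma elementary_divisor_hit:
  assumes G: "signed_graph G" and v: "v \<in> verts G"
  shows "\<exists>c. \<forall>w\<in>verts G. (\<Sum>e\<in>edges G. reduced_inc G w e * c e) =
    (if w = v then elementary_divisor G v else 0)"
proof -
  have finV: "finite (verts G)" using G by (rule finite_verts)
  have transfer: "\<exists>c. \<forall>w\<in>verts G. (\<Sum>e\<in>edges G. reduced_inc G w e * c e) = l w"
    if k: "k \<in> boundary_lattice G"
      and l: "\<And>w. w \<in> verts G \<Longrightarrow> (\<Sum>x\<in>verts G. switch_rows G w x * k x) = l w" for k l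
  proof -
    obtain c where c: "\<And>x. x \<in> verts G \<Longrightarrow> (\<Sum>e\<in>edges G. inc G x e * c e) = k x"
      using k by (auto simp: boundary_lattice_def)
    have "(\<Sum>e\<in>edges G. reduced_inc G w e * c e) = l w" if "w \<in> verts G" for w
    proof -
      have "(\<Sum>e\<in>edges G. reduced_inc G w e * c e) =
          (\<Sum>e\<in>edges G. \<Sum>x\<in>verts G. switch_rows G w x * (inc G x e * c e))"
        unfolding reduced_inc_def by (simp add: sum_distrib_right mult.assoc)
      also have "\<dots> = (\<Sum>x\<in>verts G. switch_rows G w x * (\<Sum>e\<in>edges G. inc G x e * c e))"
        by (subst sum.swap) (simp add: sum_distrib_left)
      also have "\<dots> = (\<Sum>x\<in>verts G. switch_rows G w x * k x)" using c by simp
      finally show ?thesis using l that by simp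
    qed
    then show ?thesis by blast
  qed
  have switch_ind: "(\<Sum>x\<in>verts G. switch_rows G w x * ind y x) = switch_rows G w y"
    if "y \<in> verts G" for w y using sum_ind(1) [OF finV that] .
  show ?thesis
  proof (cases "v \<in> comp_roots G")
    case True
    let ?m = "elementary_divisor G v"
    show ?thesis
    proof (rule transfer [OF ind_root_boundary [OF G True refl]])
      fix w
      have "(\<Sum>x\<in>verts G. switch_rows G w x * (?m * ind v x)) =
          ?m * (\<Sum>x\<in>verts G. switch_rows G w x * ind v x)"
        by (simp only: sum_distrib_left mult.left_commute)
      then show "(\<Sum>x\<in>verts G. switch_rows G w x * (?m * ind v x)) = (if w = v then ?m else 0)"
        unfolding switch_ind [OF v] using True root_of_root [OF True]
        by (auto simp: switch_rows_def walk_sign_root)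
    qed
  next
    case False
    let ?r = "comp_root G v"
    have r: "?r \<in> comp_roots G" using v by (rule root_in_roots)
    have rV: "?r \<in> verts G" using root_of_root [OF r] by simp
    show ?thesis
    proof (rule transfer [OF signed_walk_boundary [OF signed_walk_walk_sign [OF v] G]])
      fix w
      have "(\<Sum>x\<in>verts G. switch_rows G w x * (ind v x - walk_sign G v * ind ?r x)) =
          switch_rows G w v - walk_sign G v * switch_rows G w ?r"
        unfolding switch_ind [OF v, symmetric] switch_ind [OF rV, symmetric]
        by (simp only: sum_distrib_left right_diff_distrib sum_subtractf mult.left_commute)
      then show "(\<Sum>x\<in>verts G. switch_rows G w x * (ind v x - walk_sign G v * ind ?r x)) =
          (if w = v then elementary_divisor G v else 0)"
        using False r root_of_root [OF r]
        by (auto simp: switch_rows_def elementary_divisor_def walk_sign_root)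
    qed
  qed
qed

context comm_group begin

lemma int_kernel_reduced_inc:
  assumes G': "signed_graph H"
  shows "int_kernel (edges H) (verts H) (inc H) = int_kernel (edges H) (verts H) (reduced_inc H)"
proof
  have fin: "finite (edges H)" "finite (verts H)"
    using G' by (simp_all add: finite_edges finite_verts)
  show "int_kernel (edges H) (verts H) (inc H) \<subseteq> int_kernel (edges H) (verts H) (reduced_inc H)"
    using fin reduced_inc_def by (rule int_kernel_row_operations)
  \<comment> \<open>The inverse row operation: subtract from the row of a root the other rows of its component.\<close>
  let ?T = "\<lambda>v w. if v \<in> comp_roots H \<and> w \<noteq> v then - switch_rows H v w else of_bool (w = v)"
  show "int_kernel (edges H) (verts H) (reduced_inc H) \<subseteq> int_kernel (edges H) (verts H) (inc H)"
  proof (rule int_kernel_row_operations [where T = ?T, OF fin])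
    fix v e assume v: "v \<in> verts H"
    show "inc H v e = (\<Sum>w\<in>verts H. ?T v w * reduced_inc H w e)"
    proof (cases "v \<in> comp_roots H")
      case False
      then show ?thesis
        using v fin by (simp add: sum_ind reduced_inc_nonroot [OF G'] del: of_bool_eq)
    next
      case True
      have nonroot: "w \<notin> comp_roots H" if "switch_rows H v w \<noteq> 0" "w \<noteq> v" for w
        using that True root_of_root [of w H] by (auto simp: switch_rows_def)
      have rest: "switch_rows H v w * reduced_inc H w e = switch_rows H v w * inc H w e"
        if "w \<in> verts H" "w \<noteq> v" for w
        using that nonroot [of w] reduced_inc_nonroot [OF G' that(1)]
        by (cases "switch_rows H v w = 0") auto
      have "(\<Sum>w\<in>verts H. ?T v w * reduced_inc H w e) =
          reduced_inc H v e - (\<Sum>w\<in>verts H - {v}. switch_rows H v w * reduced_inc H w e)"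
        using v fin True by (subst sum.remove [of _ v]) (auto simp: sum_negf [symmetric])
      also have "(\<Sum>w\<in>verts H - {v}. switch_rows H v w * reduced_inc H w e) =
          (\<Sum>w\<in>verts H - {v}. switch_rows H v w * inc H w e)"
        using rest by (intro sum.cong) auto
      also have "reduced_inc H v e =
          switch_rows H v v * inc H v e + (\<Sum>w\<in>verts H - {v}. switch_rows H v w * inc H w e)"
        unfolding reduced_inc_def using v fin by (subst sum.remove [of _ v]) auto
      also have "switch_rows H v v = 1"
        using True root_of_root [OF True] by (simp add: switch_rows_def walk_sign_root)
      finally show ?thesis by simp
    qed
  qed
qed

text \<open>
  Both sides are multiplied by \<open>|A| ^ |V|\<close>, so that no subtraction of exponents occurs; that the
  exponent of \<open>|A|\<close> is nonnegative is only known afterwards.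
\<close>

lemma card_int_kernel_inc:
  assumes H: "signed_graph H" and fin: "finite (carrier G)"
  shows "card (int_kernel (edges H) (verts H) (inc H)) * card (carrier G) ^ card (verts H) =
    card (carrier G) ^ card (edges H) * card (Tor2 G) ^ unbal_closed H (edges H) *
    card (carrier G) ^ bal H (edges H)"
proof -
  let ?V = "verts H" and ?x = "card (carrier G)" and ?t = "card (Tor2 G)"
  let ?pow = "\<lambda>v. card ((\<lambda>a. a [^] elementary_divisor H v) ` carrier G)"
  let ?B = "{v \<in> comp_roots H. balanced (component_of H v)}"
  let ?U = "{v \<in> comp_roots H. \<not> balanced (component_of H v) \<and> \<not> has_outer_edge (component_of H v)}"
  have finH: "finite (edges H)" "finite ?V" using H by (simp_all add: finite_edges finite_verts)
  have sub: "?B \<subseteq> ?V" "?U \<subseteq> ?V" using comp_roots_subset [of H] by auto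
  have spanning: "spanning H (edges H) = H" by (simp add: spanning_def)
  have bal: "bal H (edges H) = card ?B"
    unfolding bal_def spanning by (rule card_components)
  have unbal: "unbal_closed H (edges H) = card ?U"
    unfolding unbal_closed_def spanning by (rule card_components)
  have count: "card (int_kernel (edges H) ?V (inc H)) * (\<Prod>v\<in>?V. ?pow v) = ?x ^ card (edges H)"
    unfolding int_kernel_reduced_inc [OF H]
    by (intro card_int_kernel_diagonal finH fin elementary_divisor_dvd [OF H]
        elementary_divisor_hit [OF H])
  \<comment> \<open>Each vertex contributes \<open>|A|\<close>: the missing factor at a root is \<open>|Tor2 A|\<close>, \<open>|A|\<close> or \<open>1\<close>.\<close>
  have "(\<Prod>v\<in>?V. ?pow v) * ?t ^ card ?U * ?x ^ card ?B =
      (\<Prod>v\<in>?V. ?pow v) * (\<Prod>v\<in>?V. if v \<in> ?U then ?t else 1) * (\<Prod>v\<in>?V. if v \<in> ?B then ?x else 1)"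
    using finH sub by (simp add: prod.If_cases Int_absorb1 del: mem_Collect_eq)
  also have "\<dots> = (\<Prod>v\<in>?V. ?pow v * (if v \<in> ?U then ?t else 1) * (if v \<in> ?B then ?x else 1))"
    by (simp only: prod.distrib)
  also have "\<dots> = (\<Prod>v\<in>?V. ?x)"
  proof (intro prod.cong refl)
    fix v
    have one: "(\<lambda>a. a [^] (1::int)) ` carrier G = carrier G" by (force simp: image_iff)
    have zero: "(\<lambda>a. \<one>) ` carrier G = {\<one>}" by auto
    have bo: "balanced (component_of H v) \<Longrightarrow> \<not> has_outer_edge (component_of H v)"
      by (simp add: balanced_def)
    show "?pow v * (if v \<in> ?U then ?t else 1) * (if v \<in> ?B then ?x else 1) = ?x"
      using card_squares_times_Tor2 [OF fin] bo
      by (auto simp: elementary_divisor_def one zero mult.commute)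
  qed
  finally have "(\<Prod>v\<in>?V. ?pow v) * ?t ^ card ?U * ?x ^ card ?B = ?x ^ card ?V" by simp
  then have "card (int_kernel (edges H) ?V (inc H)) * ?x ^ card ?V =
      card (int_kernel (edges H) ?V (inc H)) * ((\<Prod>v\<in>?V. ?pow v) * ?t ^ card ?U * ?x ^ card ?B)"
    by simp
  also have "\<dots> = ?x ^ card (edges H) * ?t ^ card ?U * ?x ^ card ?B"
    unfolding count [symmetric] by (simp only: mult.assoc)
  finally show ?thesis unfolding bal unbal .
qed

end


section \<open>Sample groups\<close>

lemma Tor2_eq:
  assumes "comm_group A" shows "Tor2 A = {a \<in> carrier A. a \<otimes>\<^bsub>A\<^esub> a = \<one>\<^bsub>A\<^esub>}"
proof -
  interpret comm_group A by fact
  show ?thesis by (auto simp: Tor2_def numeral_2_eq_2)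
qed

lemma isomorphic_copy_on_nat:
  fixes B :: "'b monoid"
  assumes B: "comm_group B" and fin: "finite (carrier B)"
  obtains A :: "nat monoid" where "comm_group A" "finite (carrier A)"
    "card (carrier A) = card (carrier B)" "card (Tor2 A) = card (Tor2 B)"
proof -
  interpret B: comm_group B by fact
  obtain h :: "'b \<Rightarrow> nat" where h: "inj_on h (carrier B)"
    using finite_imp_inj_to_nat_seg [OF fin] by blast
  define g where "g = inv_into (carrier B) h"
  have gh: "g (h a) = a" if "a \<in> carrier B" for a
    using h that by (simp add: g_def)
  define A :: "nat monoid" where
    "A = \<lparr>carrier = h ` carrier B, monoid.mult = \<lambda>x y. h (g x \<otimes>\<^bsub>B\<^esub> g y), one = h \<one>\<^bsub>B\<^esub>\<rparr>"
  have A: "comm_group A"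
  proof (rule comm_groupI)
    fix x assume "x \<in> carrier A"
    then obtain a where a: "a \<in> carrier B" "x = h a" by (auto simp: A_def)
    then show "\<exists>y\<in>carrier A. y \<otimes>\<^bsub>A\<^esub> x = \<one>\<^bsub>A\<^esub>"
      by (intro bexI [of _ "h (inv\<^bsub>B\<^esub> a)"]) (auto simp: A_def gh)
  qed (auto simp: A_def gh B.m_assoc B.m_comm B.m_lcomm)
  have "Tor2 A = h ` Tor2 B"
    unfolding Tor2_eq [OF A] Tor2_eq [OF B]
    by (auto simp: A_def gh inj_on_eq_iff [OF h])
  then have "card (Tor2 A) = card (Tor2 B)"
    by (metis (no_types, lifting) Tor2_def card_image h inj_on_subset mem_Collect_eq subsetI)
  moreover have "card (carrier A) = card (carrier B)" using h by (simp add: A_def card_image)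
  moreover have "finite (carrier A)" using fin by (simp add: A_def)
  ultimately show thesis using that A by blast
qed

text \<open>
  The group \<open>\<int>\<^sub>2 ^ k \<times> \<int>\<^sub>n\<close>, with subsets under symmetric difference for the first factor.
\<close>

definition sample_group :: "nat \<Rightarrow> nat \<Rightarrow> (nat set \<times> nat) monoid" where
  "sample_group k n = \<lparr>carrier = Pow {..<k} \<times> {..<n},
     monoid.mult = \<lambda>(X, a) (Y, b). ((X - Y) \<union> (Y - X), (a + b) mod n), one = ({}, 0)\<rparr>"

lemma comm_group_sample_group:
  assumes "0 < n" shows "comm_group (sample_group k n)"
proof (rule comm_groupI)
  fix x assume "x \<in> carrier (sample_group k n)"
  then obtain X a where x: "x = (X, a)" "X \<subseteq> {..<k}" "a < n" by (auto simp: sample_group_def)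
  have "((n - a) mod n + a) mod n = 0" using x(3) by (simp add: mod_add_left_eq)
  then show "\<exists>y\<in>carrier (sample_group k n). y \<otimes>\<^bsub>sample_group k n\<^esub> x = \<one>\<^bsub>sample_group k n\<^esub>"
    using x assms by (intro bexI [of _ "(X, (n - a) mod n)"]) (auto simp: sample_group_def)
qed (use assms in \<open>auto simp: sample_group_def mod_simps ac_simps\<close>)

lemma card_sample_group: "card (carrier (sample_group k n)) = 2 ^ k * n"
  by (simp add: sample_group_def card_cartesian_product card_Pow)

lemma card_Tor2_sample_group:
  assumes "odd n" shows "card (Tor2 (sample_group k n)) = 2 ^ k"
proof -
  have n: "0 < n" using assms by (auto intro: Nat.gr0I)
  have "a = 0" if "a < n" "(a + a) mod n = 0" for a
  proof -
    have "n dvd 2 * a" using that by (simp add: mod_eq_0_iff_dvd mult_2)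
    then have "n dvd a" using assms by (simp add: coprime_dvd_mult_right_iff)
    then show ?thesis using that by (auto dest: dvd_imp_le)
  qed
  then have "Tor2 (sample_group k n) = Pow {..<k} \<times> {0}"
    unfolding Tor2_eq [OF comm_group_sample_group [OF n]]
    using n by (auto simp: sample_group_def)
  then show ?thesis by (simp add: card_cartesian_product card_Pow)
qed

lemma nat_group_with_card:
  assumes "odd n"
  obtains A :: "nat monoid" where "comm_group A" "finite (carrier A)"
    "card (carrier A) = 2 ^ k * n" "card (Tor2 A) = 2 ^ k"
proof -
  have n: "0 < n" using assms by (auto intro: Nat.gr0I)
  have "finite (carrier (sample_group k n))" by (simp add: sample_group_def)
  then obtain A :: "nat monoid" where "comm_group A" "finite (carrier A)"
    "card (carrier A) = card (carrier (sample_group k n))"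
    "card (Tor2 A) = card (Tor2 (sample_group k n))"
    by (rule isomorphic_copy_on_nat [OF comm_group_sample_group [OF n]])
  then show thesis using that card_sample_group card_Tor2_sample_group [OF assms] by simp
qed


section \<open>The number of flows of a spanning subgraph\<close>

lemma signed_graph_spanning: "signed_graph G \<Longrightarrow> S \<subseteq> edges G \<Longrightarrow> signed_graph (spanning G S)"
  unfolding signed_graph_def spanning_def by (auto intro: finite_subset)

lemma card_int_kernel_spanning:
  assumes A: "comm_group A" "finite (carrier A)" and G: "signed_graph G" "S \<subseteq> edges G"
  shows "card (comm_group.int_kernel A S (verts G) (inc G)) * card (carrier A) ^ card (verts G) =
    card (carrier A) ^ card S * card (Tor2 A) ^ unbal_closed G S * card (carrier A) ^ bal G S"
proof -
  have "inc (spanning G S) = inc G" by (simp add: fun_eq_iff inc_def spanning_def)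
  moreover have "bal (spanning G S) S = bal G S" "unbal_closed (spanning G S) S = unbal_closed G S"
    by (simp_all add: bal_def unbal_closed_def spanning_def)
  moreover have "edges (spanning G S) = S" "verts (spanning G S) = verts G"
    by (simp_all add: spanning_def)
  ultimately show ?thesis
    using comm_group.card_int_kernel_inc [OF A(1) signed_graph_spanning [OF G] A(2)] by simp
qed

lemma Tor2_pos:
  assumes "comm_group A" "finite (carrier A)"
  shows "0 < card (Tor2 A)" "0 < card (carrier A)"
proof -
  interpret comm_group A by fact
  have "\<one>\<^bsub>A\<^esub> \<in> Tor2 A" by (simp add: Tor2_def)
  moreover have "finite (Tor2 A)" using assms(2) by (simp add: Tor2_def)
  ultimately show "0 < card (Tor2 A)" by (auto simp: card_gt_0_iff)
  show "0 < card (carrier A)" using assms(2) by (auto simp: card_gt_0_iff)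
qed

text \<open>
  Over \<open>\<int>\<^sub>3\<close> there is no 2-torsion, so the number of flows is \<open>3\<close> to the power \<open>corank G S\<close>. It is a
  positive integer, which settles the sign of the exponent without any counting in the graph.
\<close>

lemma corank_nonneg:
  assumes G: "signed_graph G" "S \<subseteq> edges G"
  shows "corank G S \<ge> 0"
proof -
  obtain A :: "nat monoid" where A: "comm_group A" "finite (carrier A)"
    and card: "card (carrier A) = 3" "card (Tor2 A) = 1"
    using nat_group_with_card [of 3 0] by auto
  let ?K = "comm_group.int_kernel A S (verts G) (inc G)"
  have eq: "card ?K * 3 ^ card (verts G) = 3 ^ (card S + bal G S)"
    using card_int_kernel_spanning [OF A G] by (simp add: card power_add)
  then have "0 < card ?K" by (metis gr0I mult_0 power_eq_0_iff zero_neq_numeral)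
  then have "(3::nat) ^ card (verts G) \<le> 3 ^ (card S + bal G S)" by (subst eq [symmetric]) simp
  then have "card (verts G) \<le> card S + bal G S" by (rule power_le_imp_le_exp [rotated]) simp
  then show ?thesis by (simp add: corank_def)
qed

lemma card_int_kernel_eq:
  assumes A: "comm_group A" "finite (carrier A)" and G: "signed_graph G" "S \<subseteq> edges G"
  shows "card (comm_group.int_kernel A S (verts G) (inc G)) =
    card (Tor2 A) ^ unbal_closed G S * card (carrier A) ^ nat (corank G S)"
proof -
  let ?x = "card (carrier A)" and ?t = "card (Tor2 A) ^ unbal_closed G S"
  have "card S + bal G S = nat (corank G S) + card (verts G)"
    using corank_nonneg [OF G] by (simp add: corank_def)
  then have x: "?x ^ card S * ?x ^ bal G S = ?x ^ nat (corank G S) * ?x ^ card (verts G)"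
    by (metis power_add)
  have "card (comm_group.int_kernel A S (verts G) (inc G)) * ?x ^ card (verts G) =
      ?t * (?x ^ card S * ?x ^ bal G S)"
    unfolding card_int_kernel_spanning [OF A G] by (simp only: ac_simps)
  also have "\<dots> = (?t * ?x ^ nat (corank G S)) * ?x ^ card (verts G)"
    unfolding x by (simp only: ac_simps)
  finally show ?thesis using Tor2_pos [OF A] by simp
qed


section \<open>Nowhere-zero flows by inclusion-exclusion\<close>

context comm_group begin

lemma int_comb_neutral:
  assumes "finite I" "J \<subseteq> I" "f \<in> I \<rightarrow> carrier G" "\<And>i. i \<in> I - J \<Longrightarrow> f i = \<one>"
  shows "int_comb I c f = int_comb J c f"
  unfolding int_comb_def using assms by (intro finprod_mono_neutral_cong_right) auto

text \<open>
  For an incidence matrix, dropping the columns in \<open>X\<close> deletes the edges in \<open>X\<close>.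
\<close>

lemma card_int_kernel_vanishing:
  assumes "finite I" "X \<subseteq> I"
  shows "card {f \<in> int_kernel I J M. \<forall>x\<in>X. f x = \<one>} = card (int_kernel (I - X) J M)"
proof (rule bij_betw_same_card)
  let ?res = "\<lambda>f. restrict f (I - X)"
  let ?ext = "\<lambda>g. \<lambda>i\<in>I. if i \<in> X then \<one> else g i"
  show "bij_betw ?res {f \<in> int_kernel I J M. \<forall>x\<in>X. f x = \<one>} (int_kernel (I - X) J M)"
  proof (rule bij_betwI [where g = ?ext])
    show "?res \<in> {f \<in> int_kernel I J M. \<forall>x\<in>X. f x = \<one>} \<rightarrow> int_kernel (I - X) J M"
    proof
      fix f assume f: "f \<in> {f \<in> int_kernel I J M. \<forall>x\<in>X. f x = \<one>}"
      then have fI: "f \<in> I \<rightarrow> carrier G" by (auto simp: int_kernel_def)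
      have "int_comb (I - X) c (?res f) = int_comb I c f" for c
      proof -
        have "int_comb (I - X) c (?res f) = int_comb (I - X) c f"
          using fI by (intro int_comb_cong) auto
        also have "\<dots> = int_comb I c f"
          using f fI assms by (intro int_comb_neutral [symmetric]) auto
        finally show ?thesis .
      qed
      then show "?res f \<in> int_kernel (I - X) J M" using f fI by (auto simp: int_kernel_def)
    qed
    show "?ext \<in> int_kernel (I - X) J M \<rightarrow> {f \<in> int_kernel I J M. \<forall>x\<in>X. f x = \<one>}"
    proof
      fix g assume g: "g \<in> int_kernel (I - X) J M"
      then have gI: "g \<in> I - X \<rightarrow> carrier G" by (auto simp: int_kernel_def)
      have "int_comb I c (?ext g) = int_comb (I - X) c g" for c
      proof -
        have "int_comb I c (?ext g) = int_comb (I - X) c (?ext g)"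
          using gI assms by (intro int_comb_neutral) auto
        also have "\<dots> = int_comb (I - X) c g" using gI by (intro int_comb_cong) auto
        finally show ?thesis .
      qed
      then show "?ext g \<in> {f \<in> int_kernel I J M. \<forall>x\<in>X. f x = \<one>}"
        using g gI assms by (auto simp: int_kernel_def)
    qed
  next
    fix f assume "f \<in> {f \<in> int_kernel I J M. \<forall>x\<in>X. f x = \<one>}"
    then have "f \<in> extensional I" "\<forall>x\<in>X. f x = \<one>" by (auto simp: int_kernel_def PiE_def)
    then show "?ext (?res f) = f" by (auto simp: fun_eq_iff extensional_def)
  next
    fix g assume "g \<in> int_kernel (I - X) J M"
    then have "g \<in> extensional (I - X)" by (auto simp: int_kernel_def PiE_def)
    then show "?res (?ext g) = g" by (auto simp: fun_eq_iff extensional_def)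
  qed
qed

text \<open>
  Expand, for each \<open>f\<close>, the product of \<open>1 - [f i = \<one>]\<close> over all \<open>i\<close>, and collect the terms by the
  set on which \<open>f\<close> is required to vanish, which is the complement of \<open>S\<close>.
\<close>

lemma card_nonvanishing_kernel:
  assumes fin: "finite I" "finite (carrier G)"
  shows "int (card {f \<in> int_kernel I J M. \<forall>i\<in>I. f i \<noteq> \<one>}) =
    (\<Sum>S\<in>Pow I. (-1) ^ card (I - S) * int (card (int_kernel S J M)))"
proof -
  let ?K = "int_kernel I J M"
  have finK: "finite ?K"
    by (rule finite_subset [of _ "I \<rightarrow>\<^sub>E carrier G"]) (auto simp: int_kernel_def finite_PiE fin)
  have count: "int (card {f \<in> ?K. P f}) = (\<Sum>f\<in>?K. of_bool (P f))" for P
    using finK by (simp add: Int_def)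
  have of_bool_prod: "of_bool (\<forall>x\<in>X. Q x) = (\<Prod>x\<in>X. of_bool (Q x) :: int)"
    if "finite X" for X Q
    using that by induction auto
  have "int (card {f \<in> ?K. \<forall>i\<in>I. f i \<noteq> \<one>}) = (\<Sum>f\<in>?K. \<Prod>i\<in>I. 1 - of_bool (f i = \<one>))"
    unfolding count by (simp add: of_bool_prod fin of_bool_not_iff)
  also have "\<dots> = (\<Sum>f\<in>?K. \<Sum>X\<in>Pow I. (-1) ^ card X * of_bool (\<forall>x\<in>X. f x = \<one>))"
    using fin by (intro sum.cong refl)
      (auto simp: prod_diff_conv_sum of_bool_prod finite_subset intro!: sum.cong)
  also have "\<dots> = (\<Sum>X\<in>Pow I. (-1) ^ card X * int (card {f \<in> ?K. \<forall>x\<in>X. f x = \<one>}))"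
    unfolding count by (subst sum.swap) (simp add: sum_distrib_left)
  also have "\<dots> = (\<Sum>X\<in>Pow I. (-1) ^ card X * int (card (int_kernel (I - X) J M)))"
    by (intro sum.cong refl) (simp add: card_int_kernel_vanishing fin)
  also have "\<dots> = (\<Sum>S\<in>Pow I. (-1) ^ card (I - S) * int (card (int_kernel S J M)))"
    by (rule sum.reindex_bij_witness [where i = "\<lambda>S. I - S" and j = "\<lambda>S. I - S"])
      (auto simp: double_diff)
  finally show ?thesis .
qed

end


section \<open>Flows as functions on edges\<close>

text \<open>
  The arc that underlies the matrix \<open>inc\<close>.
\<close>

definition ref_orientation :: "('v, 'e) sgraph \<Rightarrow> 'e \<Rightarrow> bool \<Rightarrow> int" where
  "ref_orientation G e i = (if i then 1 else - esign G e)"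

lemma orientations_eq:
  assumes "signed_graph G" "e \<in> edges G"
  shows "orientations G e = {ref_orientation G e, \<lambda>i. - ref_orientation G e i}"
proof -
  have sign: "esign G e = 1 \<or> esign G e = -1" using assms by (auto simp: signed_graph_def)
  have "d \<in> orientations G e \<longleftrightarrow> d = ref_orientation G e \<or> d = (\<lambda>i. - ref_orientation G e i)" for d
    using sign unfolding orientations_def fun_eq_iff all_bool_eq mem_Collect_eq
    by (auto simp: ref_orientation_def)
  then show ?thesis by auto
qed

lemma ref_orientation_neq: "ref_orientation G e \<noteq> (\<lambda>i. - ref_orientation G e i)"
  by (auto simp: fun_eq_iff ref_orientation_def intro: exI [of _ True])

lemma incidence_ref:
  assumes "signed_graph G" "e \<in> edges G"
  shows "incidence G v (e, ref_orientation G e) = inc G v e"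
proof -
  have "esign G e = 1 \<or> esign G e = -1" using assms by (auto simp: signed_graph_def)
  then show ?thesis
    by (auto simp: incidence_def inc_def is_loop_def ref_orientation_def)
qed

lemma incidence_uminus: "incidence G v (e, \<lambda>i. - d i) = - incidence G v (e, d)"
  by (simp add: incidence_def)

lemma arcs_iff:
  assumes "signed_graph G"
  shows "(e, d) \<in> arcs G \<longleftrightarrow>
    e \<in> edges G \<and> (d = ref_orientation G e \<or> d = (\<lambda>i. - ref_orientation G e i))"
  using orientations_eq [OF assms, of e] by (auto simp: arcs_def)

context comm_group begin

text \<open>
  A flow is determined by its values on the reference arcs. The conservation law does not depend on the
  choice of the arcs: reversing an arc inverts both the value and the exponent.
\<close>

lemma card_nz_flows:
  fixes H :: "('v, 'e) sgraph"
  assumes H: "signed_graph H"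
  shows "card (nz_flows H G) =
    card {f \<in> int_kernel (edges H) (verts H) (inc H). \<forall>e\<in>edges H. f e \<noteq> \<one>}"
    (is "_ = card ?K")
proof (rule bij_betw_same_card)
  let ?w = "ref_orientation H"
  let ?\<phi> = "\<lambda>f. \<lambda>e\<in>edges H. f (e, ?w e)"
  let ?\<psi> = "\<lambda>k. \<lambda>a\<in>arcs H. if snd a = ?w (fst a) then k (fst a) else inv (k (fst a))"
  have w_Pi: "?w \<in> Pi (edges H) (orientations H)" using orientations_eq [OF H] by auto
  have inv_neq_one: "inv a \<noteq> \<one>" if "a \<in> carrier G" "a \<noteq> \<one>" for a
    using that by (metis inv_inv inv_one)
  show "bij_betw ?\<phi> (nz_flows H G) ?K"
  proof (rule bij_betwI [where g = ?\<psi>])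
    show "?\<phi> \<in> nz_flows H G \<rightarrow> ?K"
    proof
      fix f assume f: "f \<in> nz_flows H G"
      then have fl: "f \<in> flows H G" by (simp add: nz_flows_def)
      then have fc: "f a \<in> carrier G" if "a \<in> arcs H" for a
        using that by (auto simp: flows_def)
      have arc: "(e, ?w e) \<in> arcs H" if "e \<in> edges H" for e using that arcs_iff [OF H] by blast
      have "int_comb (edges H) (inc H v) (?\<phi> f) = \<one>" if v: "v \<in> verts H" for v
      proof -
        have "int_comb (edges H) (inc H v) (?\<phi> f) =
            (\<Otimes>e\<in>edges H. f (e, ?w e) [^] incidence H v (e, ?w e))"
          unfolding int_comb_def using fc arc incidence_ref [OF H]
          by (intro finprod_cong') auto
        also have "\<dots> = \<one>" using fl w_Pi v by (simp add: flows_def)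
        finally show ?thesis .
      qed
      then show "?\<phi> f \<in> ?K"
        using f fc arc by (auto simp: int_kernel_def nz_flows_def)
    qed
    show "?\<psi> \<in> ?K \<rightarrow> nz_flows H G"
    proof
      fix k assume k: "k \<in> ?K"
      then have kc: "k e \<in> carrier G" if "e \<in> edges H" for e
        using that by (auto simp: int_kernel_def)
      have \<psi>: "?\<psi> k (e, ?w e) = k e" "?\<psi> k (e, \<lambda>i. - ?w e i) = inv (k e)" if "e \<in> edges H" for e
        using that arcs_iff [OF H] ref_orientation_neq [of H e] by auto
      have "?\<psi> k a \<in> carrier G \<and> ?\<psi> k (arc_inv a) = inv (?\<psi> k a) \<and> ?\<psi> k a \<noteq> \<one>"
        if "a \<in> arcs H" for a
      proof -
        obtain e d where a: "a = (e, d)" by (cases a)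
        then have e: "e \<in> edges H" and d: "d = ?w e \<or> d = (\<lambda>i. - ?w e i)"
          using that arcs_iff [OF H] by auto
        have "k e \<noteq> \<one>" using k e by simp
        from d show ?thesis
        proof
          assume "d = ?w e"
          then show ?thesis unfolding a arc_inv_def fst_conv snd_conv
            using \<psi> [OF e] kc [OF e] \<open>k e \<noteq> \<one>\<close> by (simp only:) simp
        next
          assume "d = (\<lambda>i. - ?w e i)"
          then show ?thesis unfolding a arc_inv_def fst_conv snd_conv
            using \<psi> [OF e] kc [OF e] inv_neq_one [OF kc [OF e] \<open>k e \<noteq> \<one>\<close>]
            by (simp only: minus_minus) simp
        qed
      qed
      note pointwise = this
      have "(\<Otimes>e\<in>edges H. ?\<psi> k (e, w e) [^] incidence H v (e, w e)) = \<one>"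
        if w: "w \<in> Pi (edges H) (orientations H)" and v: "v \<in> verts H" for w v
      proof -
        have "?\<psi> k (e, w e) [^] incidence H v (e, w e) = k e [^] inc H v e" if e: "e \<in> edges H" for e
        proof -
          have "w e = ?w e \<or> w e = (\<lambda>i. - ?w e i)" using w e orientations_eq [OF H e] by auto
          then show ?thesis
          proof
            assume "w e = ?w e"
            then show ?thesis using \<psi>(1) [OF e] incidence_ref [OF H e] by (simp only:)
          next
            assume "w e = (\<lambda>i. - ?w e i)"
            then have "?\<psi> k (e, w e) [^] incidence H v (e, w e) = inv (k e) [^] (- inc H v e)"
              using \<psi>(2) [OF e] incidence_ref [OF H e] by (simp only: incidence_uminus)
            also have "\<dots> = k e [^] inc H v e"
              using kc [OF e] by (simp add: int_pow_neg int_pow_inv)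
            finally show ?thesis .
          qed
        qed
        then have "(\<Otimes>e\<in>edges H. ?\<psi> k (e, w e) [^] incidence H v (e, w e)) =
            int_comb (edges H) (inc H v) k"
          unfolding int_comb_def using kc by (intro finprod_cong') auto
        then show ?thesis using k v by (simp add: int_kernel_def)
      qed
      moreover have "?\<psi> k \<in> arcs H \<rightarrow>\<^sub>E carrier G"
        unfolding PiE_iff using pointwise restrict_extensional by blast
      ultimately show "?\<psi> k \<in> nz_flows H G"
        using pointwise unfolding nz_flows_def flows_def mem_Collect_eq
        by (intro conjI ballI) blast+
    qed
  next
    fix f assume f: "f \<in> nz_flows H G"
    then have inv: "f (arc_inv a) = inv (f a)" if "a \<in> arcs H" for a
      using that by (auto simp: nz_flows_def flows_def)
    have ext: "f \<in> extensional (arcs H)" using f by (auto simp: nz_flows_def flows_def PiE_def)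
    show "?\<psi> (?\<phi> f) = f"
    proof
      fix a :: "'e arc"
      obtain e d where a: "a = (e, d)" by (cases a)
      show "?\<psi> (?\<phi> f) a = f a"
      proof (cases "a \<in> arcs H")
        case False
        then show ?thesis using extensional_arb [OF ext, of a] by simp
      next
        case True
        then have e: "e \<in> edges H" and d: "d = ?w e \<or> d = (\<lambda>i. - ?w e i)"
          using a arcs_iff [OF H] by auto
        have "f (e, \<lambda>i. - ?w e i) = inv (f (e, ?w e))"
          using inv [of "(e, ?w e)"] e arcs_iff [OF H] by (auto simp: arc_inv_def)
        then show ?thesis
          using d a e True ref_orientation_neq [of H e] by auto
      qed
    qed
  next
    fix k assume k: "k \<in> ?K"
    then have ext: "k \<in> extensional (edges H)" by (auto simp: int_kernel_def PiE_def)
    show "?\<phi> (?\<psi> k) = k"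
    proof
      fix e show "?\<phi> (?\<psi> k) e = k e"
        using ext arcs_iff [OF H, of e] by (cases "e \<in> edges H") (auto simp: extensional_def)
    qed
  qed
qed

end


section \<open>The flow polynomial\<close>

lemma eval2_simps [simp]:
  "eval2 0 t x = 0" "eval2 1 t x = 1" "eval2 (- p) t x = - eval2 p t x"
  "eval2 (p - q) t x = eval2 p t x - eval2 q t x"
  "eval2 (p * q) t x = eval2 p t x * eval2 q t x" "eval2 (p ^ n) t x = eval2 p t x ^ n"
  "eval2 (sum f S) t x = (\<Sum>s\<in>S. eval2 (f s) t x)"
  "eval2 var_t t x = t" "eval2 var_x t x = x"
  by (simp_all add: eval2_def poly_sum var_t_def var_x_def)

text \<open>
  For each \<open>k\<close>, the polynomial in \<open>x\<close> obtained from \<open>t = 2 ^ k\<close> has infinitely many roots, hence is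
  zero. So \<open>p\<close>, as a polynomial in \<open>t\<close>, has infinitely many roots as well.
\<close>

lemma eval2_eq_0_imp_eq_0:
  fixes p :: "'c::{idom, ring_char_0} poly poly"
  assumes zero: "\<And>k n. odd n \<Longrightarrow> eval2 p (of_nat (2 ^ k)) (of_nat (2 ^ k * n)) = 0"
  shows "p = 0"
proof (rule ccontr)
  assume "p \<noteq> 0"
  have "poly p [:of_nat (2 ^ k):] = 0" for k
  proof (rule ccontr)
    assume ne: "poly p [:of_nat (2 ^ k):] \<noteq> 0"
    have "range (\<lambda>j. of_nat (2 ^ k * (2 * j + 1)) :: 'c) \<subseteq> {x. poly (poly p [:of_nat (2 ^ k):]) x = 0}"
      using zero [of "2 * _ + 1" k] unfolding eval2_def by (intro image_subsetI CollectI) simp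
    then have "finite (range (\<lambda>j. of_nat (2 ^ k * (2 * j + 1)) :: 'c))"
      using poly_roots_finite [OF ne] by (rule finite_subset)
    moreover have "inj (\<lambda>j. of_nat (2 ^ k * (2 * j + 1)) :: 'c)"
      unfolding inj_def of_nat_eq_iff by simp
    ultimately show False using finite_imageD infinite_UNIV_nat by blast
  qed
  then have "range (\<lambda>k. [:of_nat (2 ^ k):] :: 'c poly) \<subseteq> {y. poly p y = 0}" by auto
  then have "finite (range (\<lambda>k. [:of_nat (2 ^ k):] :: 'c poly))"
    using poly_roots_finite [OF \<open>p \<noteq> 0\<close>] by (rule finite_subset)
  moreover have "inj (\<lambda>k. [:of_nat (2 ^ k):] :: 'c poly)"
    unfolding inj_def pCons_eq_iff of_nat_eq_iff by simp
  ultimately show False using finite_imageD infinite_UNIV_nat by blast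
qed

lemma flow_polynomial_unique:
  fixes p q :: "'c::{idom, ring_char_0} poly poly"
  assumes p: "is_flow_polynomial G p" and q: "is_flow_polynomial G q"
  shows "p = q"
proof -
  have "p - q = 0"
  proof (rule eval2_eq_0_imp_eq_0)
    fix k n :: nat assume "odd n"
    then obtain A :: "nat monoid" where A: "comm_group A" "finite (carrier A)"
      and "card (carrier A) = 2 ^ k * n" "card (Tor2 A) = 2 ^ k"
      by (rule nat_group_with_card)
    then show "eval2 (p - q) (of_nat (2 ^ k)) (of_nat (2 ^ k * n)) = 0"
      using p q unfolding is_flow_polynomial_def counts_flows_over_def eval2_simps
      by (metis diff_self)
  qed
  then show ?thesis by simp
qed

definition subset_expansion :: "('v, 'e) sgraph \<Rightarrow> 'c::{idom, ring_char_0} poly poly" where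
  "subset_expansion G = (\<Sum>S\<in>Pow (edges G). (-1) ^ card (edges G - S) *
     var_t ^ unbal_closed G S * var_x ^ nat (corank G S))"

lemma subset_expansion_counts_flows:
  assumes G: "signed_graph G" and A: "comm_group A" "finite (carrier A)"
  shows "counts_flows_over G (subset_expansion G :: 'c::{idom, ring_char_0} poly poly) A"
proof -
  interpret comm_group A by fact
  have "int (card (nz_flows G A)) = (\<Sum>S\<in>Pow (edges G). (-1) ^ card (edges G - S) *
      int (card (Tor2 A) ^ unbal_closed G S * card (carrier A) ^ nat (corank G S)))"
    unfolding card_nz_flows [OF G] card_nonvanishing_kernel [OF finite_edges [OF G] A(2)]
    by (intro sum.cong refl) (simp add: card_int_kernel_eq [OF A G])
  then have "(of_int (int (card (nz_flows G A))) :: 'c) = of_int (\<Sum>S\<in>Pow (edges G). (-1) ^ card (edges G - S) *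
      int (card (Tor2 A) ^ unbal_closed G S * card (carrier A) ^ nat (corank G S)))"
    by (rule arg_cong)
  then show ?thesis
    by (simp add: counts_flows_over_def subset_expansion_def mult.assoc)
qed

lemma subset_expansion_is_flow_polynomial:
  "signed_graph G \<Longrightarrow> is_flow_polynomial G (subset_expansion G :: 'c::{idom, ring_char_0} poly poly)"
  by (simp add: is_flow_polynomial_def subset_expansion_counts_flows)


section \<open>Vanishing of the flow polynomial\<close>

text \<open>
  By the count of flows, an edge satisfies this iff its removal preserves the number of flows over every
  finite abelian group, that is, iff every flow vanishes on it.
\<close>

definition zero_forcing :: "('v, 'e) sgraph \<Rightarrow> 'e \<Rightarrow> bool" where
  "zero_forcing G e \<longleftrightarrow> coloop G e \<and> unbal_closed G (edges G - {e}) = unbal_closed G (edges G)"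

lemma zero_forcing_iff:
  assumes G: "signed_graph G" and e: "e \<in> edges G"
  shows "zero_forcing G e \<longleftrightarrow>
    unbal_closed G (edges G - {e}) = unbal_closed G (edges G) \<and>
    nat (corank G (edges G - {e})) = nat (corank G (edges G))"
proof -
  have "card (edges G) = card (edges G - {e}) + 1"
    using finite_edges [OF G] e by (metis Suc_eq_plus1 card.remove)
  moreover have "corank G (edges G - {e}) \<ge> 0" "corank G (edges G) \<ge> 0"
    by (intro corank_nonneg [OF G]; blast)+
  ultimately have "nat (corank G (edges G - {e})) = nat (corank G (edges G)) \<longleftrightarrow>
      bal G (edges G - {e}) = bal G (edges G) + 1"
    unfolding corank_def by linarith
  then show ?thesis using e by (auto simp: zero_forcing_def coloop_def)
qed

text \<open>
  The flows that vanish at \<open>e\<close> are as many as all flows, so they are all flows.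
\<close>

lemma no_nz_flows_if_zero_forcing:
  assumes G: "signed_graph G" and e: "zero_forcing G e" and A: "comm_group A" "finite (carrier A)"
  shows "card (nz_flows G A) = 0"
proof -
  interpret comm_group A by fact
  have eG: "e \<in> edges G" using e by (simp add: zero_forcing_def coloop_def)
  let ?K = "\<lambda>S. int_kernel S (verts G) (inc G)"
  have fin: "finite (?K (edges G))"
    by (rule finite_subset [of _ "edges G \<rightarrow>\<^sub>E carrier A"])
      (auto simp: int_kernel_def finite_PiE finite_edges [OF G] A)
  have "card {f \<in> ?K (edges G). \<forall>x\<in>{e}. f x = \<one>\<^bsub>A\<^esub>} = card (?K (edges G - {e}))"
    using eG by (intro card_int_kernel_vanishing finite_edges G) simp
  also have "\<dots> = card (?K (edges G))"
    using zero_forcing_iff [OF G eG] e by (simp add: card_int_kernel_eq [OF A G] Diff_subset)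
  finally have "{f \<in> ?K (edges G). \<forall>x\<in>{e}. f x = \<one>\<^bsub>A\<^esub>} = ?K (edges G)"
    using fin by (intro card_subset_eq) auto
  then have "{f \<in> ?K (edges G). \<forall>i\<in>edges G. f i \<noteq> \<one>\<^bsub>A\<^esub>} = {}" using eG by blast
  then show ?thesis unfolding card_nz_flows [OF G] by (simp only: card.empty)
qed

lemma two_power_times_odd_unique:
  "(2::nat) ^ a * u = 2 ^ b * v \<Longrightarrow> odd u \<Longrightarrow> odd v \<Longrightarrow> a = b"
proof (induction a arbitrary: b)
  case 0
  then show ?case by (cases b) auto
next
  case (Suc a)
  then show ?case by (cases b) auto
qed

lemma ex_power_dominates:
  fixes c n :: nat
  shows "\<exists>m. n * c ^ m < (c + 1) ^ m"
proof (cases "c = 0")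
  case True
  then show ?thesis by (intro exI [of _ 1]) simp
next
  case False
  then have "1 < (real c + 1) / real c" by simp
  then obtain m where "real n < ((real c + 1) / real c) ^ m" using real_arch_pow by blast
  then have "real n * real c ^ m < (real c + 1) ^ m"
    using False by (simp add: power_divide pos_less_divide_eq)
  then have "real (n * c ^ m) < real ((c + 1) ^ m)" by (simp add: add.commute)
  then show ?thesis using of_nat_less_iff by blast
qed

text \<open>
  Take groups with \<open>|Tor2 A| = 2 ^ m\<close> and \<open>|A| = 6 ^ m\<close>, over which \<open>(V, S)\<close> has \<open>c S ^ m\<close> flows. The
  number \<open>c S\<close> determines both exponents by unique factorisation, so \<open>c\<close> drops strictly when an edge is
  removed, and for large \<open>m\<close> the flows that vanish somewhere are outnumbered.
\<close>

lemma nz_flow_exists: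
  fixes G :: "('v, 'e) sgraph"
  assumes G: "signed_graph G" and nz: "\<And>e. \<not> zero_forcing G e"
  obtains A :: "nat monoid" where "comm_group A" "finite (carrier A)" "card (nz_flows G A) \<noteq> 0"
proof -
  let ?E = "edges G"
  let ?K = "\<lambda>(A :: nat monoid) S. comm_group.int_kernel A S (verts G) (inc G)"
  define c :: "'e set \<Rightarrow> nat" where
    "c S = 2 ^ unbal_closed G S * 6 ^ nat (corank G S)" for S
  have ex: "\<exists>A :: nat monoid. comm_group A \<and> finite (carrier A) \<and>
      (\<forall>S\<subseteq>?E. card (?K A S) = c S ^ m)" for m
  proof -
    have "odd ((3::nat) ^ m)" by simp
    then obtain A :: "nat monoid" where A: "comm_group A" "finite (carrier A)"
      and card: "card (carrier A) = 2 ^ m * 3 ^ m" "card (Tor2 A) = 2 ^ m"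
      by (rule nat_group_with_card)
    have six: "(2::nat) ^ m * 3 ^ m = 6 ^ m" by (simp add: power_mult_distrib [symmetric])
    have "card (?K A S) = c S ^ m" if "S \<subseteq> ?E" for S
      unfolding card_int_kernel_eq [OF A G that] card six c_def
      by (simp add: power_mult_distrib power_mult [symmetric] mult.commute)
    then show ?thesis using A by blast
  qed
  have finK: "finite (?K A ?E)" if A: "comm_group A" "finite (carrier A)" for A :: "nat monoid"
    by (rule finite_subset [of _ "?E \<rightarrow>\<^sub>E carrier A"])
      (auto simp: comm_group.int_kernel_def [OF A(1)] finite_PiE finite_edges [OF G] A(2))
  have vanish: "card {f \<in> ?K A ?E. f e = \<one>\<^bsub>A\<^esub>} = card (?K A (?E - {e}))"
    if A: "comm_group A" and e: "e \<in> ?E" for A :: "nat monoid" and e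
    using comm_group.card_int_kernel_vanishing [OF A finite_edges [OF G], of "{e}"] e by simp
  have smaller: "c (?E - {e}) < c ?E" if e: "e \<in> ?E" for e
  proof -
    obtain A :: "nat monoid" where A: "comm_group A" "finite (carrier A)"
      and card: "\<And>S. S \<subseteq> ?E \<Longrightarrow> card (?K A S) = c S ^ 1" using ex [of 1] by blast
    have "card {f \<in> ?K A ?E. f e = \<one>\<^bsub>A\<^esub>} \<le> card (?K A ?E)"
      by (intro card_mono finK A) auto
    then have "c (?E - {e}) \<le> c ?E" using vanish [OF A(1) e] card by (simp add: Diff_subset)
    moreover have "c (?E - {e}) \<noteq> c ?E"
    proof
      assume eq: "c (?E - {e}) = c ?E"
      have split: "c S = 2 ^ (unbal_closed G S + nat (corank G S)) * 3 ^ nat (corank G S)" for S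
      proof -
        have "(6::nat) ^ k = 2 ^ k * 3 ^ k" for k by (simp add: power_mult_distrib [symmetric])
        then show ?thesis by (simp add: c_def power_add)
      qed
      have two: "unbal_closed G (?E - {e}) + nat (corank G (?E - {e})) =
          unbal_closed G ?E + nat (corank G ?E)"
        by (rule two_power_times_odd_unique [OF eq [unfolded split]]) simp_all
      then have "nat (corank G (?E - {e})) = nat (corank G ?E)"
        using eq unfolding split by simp
      then show False using two nz [of e] zero_forcing_iff [OF G e] by simp
    qed
    ultimately show ?thesis by simp
  qed
  have "0 < c ?E" by (simp add: c_def)
  then obtain d where d: "c ?E = d + 1" by (metis Suc_eq_plus1 gr0_conv_Suc)
  obtain m where m: "card ?E * d ^ m < (d + 1) ^ m" using ex_power_dominates by blast
  obtain A :: "nat monoid" where A: "comm_group A" "finite (carrier A)"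
    and card: "\<And>S. S \<subseteq> ?E \<Longrightarrow> card (?K A S) = c S ^ m" using ex [of m] by blast
  have "card (nz_flows G A) \<noteq> 0"
  proof
    assume "card (nz_flows G A) = 0"
    then have "card {f \<in> ?K A ?E. \<forall>e\<in>?E. f e \<noteq> \<one>\<^bsub>A\<^esub>} = 0"
      using comm_group.card_nz_flows [OF A(1) G] by simp
    then have "?K A ?E \<subseteq> (\<Union>e\<in>?E. {f \<in> ?K A ?E. f e = \<one>\<^bsub>A\<^esub>})"
      using finK [OF A] by auto
    then have "card (?K A ?E) \<le> card (\<Union>e\<in>?E. {f \<in> ?K A ?E. f e = \<one>\<^bsub>A\<^esub>})"
      using finK [OF A] finite_edges [OF G] by (intro card_mono) auto
    also have "\<dots> \<le> (\<Sum>e\<in>?E. card {f \<in> ?K A ?E. f e = \<one>\<^bsub>A\<^esub>})"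
      by (intro card_UN_le finite_edges G)
    also have "\<dots> \<le> (\<Sum>e\<in>?E. d ^ m)"
    proof (rule sum_mono)
      fix e assume e: "e \<in> ?E"
      have "c (?E - {e}) \<le> d" using smaller [OF e] d by simp
      then show "card {f \<in> ?K A ?E. f e = \<one>\<^bsub>A\<^esub>} \<le> d ^ m"
        using vanish [OF A(1) e] card [of "?E - {e}"] by (simp add: power_mono Diff_subset)
    qed
    finally show False using m card [of ?E] d by simp
  qed
  then show thesis using that A by blast
qed


section \<open>Existence, uniqueness and vanishing\<close>

theorem theorem6p3:
  fixes G :: "('v, 'e) sgraph"
  assumes "signed_graph G" and "edges G \<noteq> {}"
  shows "(\<exists>!p :: 'c::{idom, ring_char_0} poly poly. is_flow_polynomial G p) \<and>
         (\<forall>A :: 'g monoid. comm_group A \<longrightarrow> finite (carrier A) \<longrightarrow>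
            counts_flows_over G (flow_polynomial G :: 'c poly poly) A) \<and>
         (flow_polynomial G :: 'c poly poly) =
           (\<Sum>S\<in>Pow (edges G). (-1) ^ card (edges G - S) *
              var_t ^ unbal_closed G S * var_x ^ nat (corank G S)) \<and>
         ((flow_polynomial G :: 'c poly poly) = 0 \<longleftrightarrow>
            (\<exists>e. coloop G e \<and> unbal_closed G (edges G - {e}) = unbal_closed G (edges G)))"
proof -
  note expansion = subset_expansion_is_flow_polynomial [OF assms(1), where 'c = 'c]
  have unique: "\<exists>!p :: 'c poly poly. is_flow_polynomial G p"
    using expansion flow_polynomial_unique by blast
  have flow: "(flow_polynomial G :: 'c poly poly) = subset_expansion G"
    unfolding flow_polynomial_def using expansion flow_polynomial_unique by (intro the_equality)
  have "(subset_expansion G :: 'c poly poly) = 0 \<longleftrightarrow> (\<exists>e. zero_forcing G e)"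
  proof
    assume zero: "(subset_expansion G :: 'c poly poly) = 0"
    show "\<exists>e. zero_forcing G e"
    proof (rule ccontr)
      assume "\<nexists>e. zero_forcing G e"
      then obtain A :: "nat monoid" where A: "comm_group A" "finite (carrier A)"
        and "card (nz_flows G A) \<noteq> 0" using nz_flow_exists [OF assms(1)] by blast
      then show False
        using subset_expansion_counts_flows [OF assms(1) A, where 'c = 'c]
        unfolding zero counts_flows_over_def by simp
    qed
  next
    assume "\<exists>e. zero_forcing G e"
    then have "is_flow_polynomial G (0 :: 'c poly poly)"
      using no_nz_flows_if_zero_forcing [OF assms(1)]
      by (auto simp: is_flow_polynomial_def counts_flows_over_def)
    then show "(subset_expansion G :: 'c poly poly) = 0"
      using expansion flow_polynomial_unique by blast
  qed
  then show ?thesis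
    using unique flow subset_expansion_counts_flows [OF assms(1), where 'c = 'c]
    unfolding zero_forcing_def subset_expansion_def by auto
qed

end
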